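(* Let $s\in(\frac12,1)$ and let $H:\mathbb{R}^n\to\mathbb{R}$ be a locally Lipschitz function satisfying $$|H(p)-H(q)|\leq C_H(|p|^{m-1}+|q|^{m-1})|p-q|\quad\text{for all }p,q\in\mathbb{R}^n,$$ where $m>1$ and $C_H>0$. Let $\mathcal I_{\rm sym}$ be a translation invariant, positively $1$-homogeneous operator which is elliptic with respect to the set of symmetric kernels $\mathcal{K}_{\rm sym}$ (see context). Then there is no non-constant viscosity solution $u$ to $$-\mathcal I_{\rm sym}u+H(\nabla u)=0\quad\text{in }\mathbb{R}^n$$ satisfying $|u(x)|\leq M(1+|x|)^\gamma$ for all $x\in\mathbb{R}^n$, for some constant $M$ and some $\gamma<\max\{\frac{m-2s}{m-1},\frac{1}{2s}\}$.
   Context: Fix $s\in(0,1)$ and $0<\lambda\leq\Lambda$. $\mathcal{K}_{\rm sym}=\mathcal{K}_{\rm sym}(\lambda,\Lambda)$ is the family of measurable kernels $K:\mathbb{R}^n\setminus\{0\}\to[0,\infty)$ with $\frac{\lambda}{|z|^{n+2s}}\leq K(z)\leq\frac{\Lambda}{|z|^{n+2s}}$ and $K(z)=K(-z)$ for $z\neq0$. With $B$ the unit ball centered at $0$, put $$L_Ku(x)=\int_{\mathbb{R}^n}\big[u(x+z)-u(x)-1_{\{2s\in[1,2)\}}1_B(z)\nabla u(x)\cdot z\big]K(z)\,dz .$$ Let $\omega_s(z)=(1+|z|)^{-n-2s}$, and let $L^1(\omega_s)$ be the functions integrable against $\omega_s$. $\mathcal I_{\rm sym}$ is a nonlocal operator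 which is translation invariant ($\mathcal I_{\rm sym}u_h(x)=\mathcal I_{\rm sym}u(x+h)$ for all $x,h$, where $u_h=u(\cdot+h)$), positively $1$-homogeneous, and elliptic with respect to $\mathcal{K}_{\rm sym}$, i.e. $$\inf_{K\in\mathcal{K}_{\rm sym}}(L_Ku(x)-L_Kv(x))\leq\mathcal I_{\rm sym}u(x)-\mathcal I_{\rm sym}v(x)\leq\sup_{K\in\mathcal{K}_{\rm sym}}(L_Ku(x)-L_Kv(x))$$ whenever $u,v\in C^{1,1}(x)\cap L^1(\omega_s)$ (where $C^{1,1}(x)$ means $C^{1,1}$ at the point $x$). Viscosity solutions: let $\Omega\subseteq\mathbb{R}^n$ be open and consider $-\mathcal I_{\rm sym}u+H(x,u,\nabla u)=0$ in $\Omega$, with $H$ continuous. A measurable $u\in L^1(\omega_s)$, upper (resp. lower) semicontinuous in $\bar\Omega$, is a viscosity subsolution (resp. supersolution) if for each $x_0\in\Omega$ and $\varphi\in C^2(B_r(x_0))$, for some $r>0$, with $u(x_0)=\varphi(x_0)$ and $u\leq\varphi$ (resp. $u\geq\varphi$) in $B_r(x_0)$, one has $-\mathcal I_{\rm sym}v(x_0)+H(x_0,u(x_0),\nabla\varphi(x_0))\leq0$ (resp. $\geq0$), where $v=\varphi$ in $B_r(x_0)$ and $v=u$ elsewhere. A viscosity solution is both a sub- and a supersolution. *)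

theory Defs
  imports "HOL-Analysis.Analysis"
begin

text \<open>Kernels are total functions; their value at the origin is unconstrained and irrelevant,
  since the integrand of \<open>nonlocal_L\<close> vanishes there.\<close>

definition K_sym :: "real \<Rightarrow> real \<Rightarrow> real \<Rightarrow> ('a::euclidean_space \<Rightarrow> real) set" where
  "K_sym s lam Lam =
     {K. K \<in> borel_measurable lebesgue \<and>
         (\<forall>z. z \<noteq> 0 \<longrightarrow>
            0 \<le> K z \<and>
            lam / norm z powr (real DIM('a) + 2 * s) \<le> K z \<and>
            K z \<le> Lam / norm z powr (real DIM('a) + 2 * s) \<and>
            K z = K (- z))}"

definition grad :: "('a::euclidean_space \<Rightarrow> real) \<Rightarrow> 'a \<Rightarrow> 'a" where
  "grad f x = (THE D. GDERIV f x :> D)"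

definition nonlocal_L :: "real \<Rightarrow> ('a::euclidean_space \<Rightarrow> real) \<Rightarrow> ('a \<Rightarrow> real) \<Rightarrow> 'a \<Rightarrow> real" where
  "nonlocal_L s K u x =
     (LINT z|lebesgue.
        (u (x + z) - u x - indicator {1..<2} (2 * s) * indicator (ball 0 1) z * (grad u x \<bullet> z)) * K z)"

text \<open>Elements of \<open>L1_weighted s\<close> are functions, not classes of functions; integrability of the
  product with the positive weight includes Lebesgue measurability of the function itself.\<close>

definition weight :: "real \<Rightarrow> 'a::euclidean_space \<Rightarrow> real" where
  "weight s z = (1 + norm z) powr (- real DIM('a) - 2 * s)"

definition L1_weighted :: "real \<Rightarrow> ('a::euclidean_space \<Rightarrow> real) set" where
  "L1_weighted s = {u. integrable lebesgue (\<lambda>z. u z * weight s z)}"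

text \<open>Pointwise \<open>C\<^sup>1\<^sup>,\<^sup>1\<close>: a first-order expansion at \<open>x\<close> with quadratic remainder
  (then necessarily \<open>p = grad u x\<close>).\<close>

definition C11_at :: "('a::euclidean_space \<Rightarrow> real) \<Rightarrow> 'a \<Rightarrow> bool" where
  "C11_at u x \<longleftrightarrow>
     (\<exists>p C r. 0 < r \<and> (\<forall>h. norm h < r \<longrightarrow> \<bar>u (x + h) - u x - p \<bullet> h\<bar> \<le> C * (norm h)\<^sup>2))"

text \<open>The operators below are total functions of type \<open>('a \<Rightarrow> real) \<Rightarrow> 'a \<Rightarrow> real\<close>. The value
  \<open>I u x\<close> is only meaningful if \<open>admissible s u x\<close>, and the structural conditions on \<open>I\<close> constrain
  it only there.\<close>

definition admissible :: "real \<Rightarrow> ('a::euclidean_space \<Rightarrow> real) \<Rightarrow> 'a \<Rightarrow> bool" where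
  "admissible s u x \<longleftrightarrow> C11_at u x \<and> u \<in> L1_weighted s"

definition translation_invariant ::
    "real \<Rightarrow> (('a::euclidean_space \<Rightarrow> real) \<Rightarrow> 'a \<Rightarrow> real) \<Rightarrow> bool" where
  "translation_invariant s I \<longleftrightarrow>
     (\<forall>u x h. admissible s u (x + h) \<longrightarrow> I (\<lambda>y. u (y + h)) x = I u (x + h))"

definition positively_homogeneous ::
    "real \<Rightarrow> (('a::euclidean_space \<Rightarrow> real) \<Rightarrow> 'a \<Rightarrow> real) \<Rightarrow> bool" where
  "positively_homogeneous s I \<longleftrightarrow>
     (\<forall>u x t. 0 < t \<longrightarrow> admissible s u x \<longrightarrow> I (\<lambda>y. t * u y) x = t * I u x)"

text \<open>For admissible \<open>u\<close> and \<open>v\<close>, the integrals \<open>nonlocal_L s K u x\<close> and \<open>nonlocal_L s K v x\<close>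
  converge absolutely and are bounded uniformly over the nonempty family \<open>K_sym s lam Lam\<close>, so the
  real-valued infimum and supremum are the true ones.\<close>

definition elliptic_sym ::
    "real \<Rightarrow> real \<Rightarrow> real \<Rightarrow> (('a::euclidean_space \<Rightarrow> real) \<Rightarrow> 'a \<Rightarrow> real) \<Rightarrow> bool" where
  "elliptic_sym s lam Lam I \<longleftrightarrow>
     (\<forall>u v x. admissible s u x \<longrightarrow> admissible s v x \<longrightarrow>
        (INF K\<in>K_sym s lam Lam. nonlocal_L s K u x - nonlocal_L s K v x) \<le> I u x - I v x \<and>
        I u x - I v x \<le> (SUP K\<in>K_sym s lam Lam. nonlocal_L s K u x - nonlocal_L s K v x))"

definition usc_on :: "'a::topological_space set \<Rightarrow> ('a \<Rightarrow> real) \<Rightarrow> bool" where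
  "usc_on S u \<longleftrightarrow> (\<forall>x\<in>S. \<forall>a>u x. eventually (\<lambda>y. u y < a) (at x within S))"

definition lsc_on :: "'a::topological_space set \<Rightarrow> ('a \<Rightarrow> real) \<Rightarrow> bool" where
  "lsc_on S u \<longleftrightarrow> (\<forall>x\<in>S. \<forall>a<u x. eventually (\<lambda>y. a < u y) (at x within S))"

text \<open>\<open>C\<^sup>2\<close> on an open set, with gradient \<open>G\<close> and Hessian \<open>Q\<close>.\<close>

definition C2_on :: "('a::euclidean_space \<Rightarrow> real) \<Rightarrow> 'a set \<Rightarrow> bool" where
  "C2_on f S \<longleftrightarrow>
     (\<exists>(G :: 'a \<Rightarrow> 'a) (Q :: 'a \<Rightarrow> 'a \<Rightarrow>\<^sub>L 'a).
        (\<forall>x\<in>S. GDERIV f x :> G x \<and> (G has_derivative blinfun_apply (Q x)) (at x)) \<and>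
        continuous_on S Q)"

definition glue :: "'a::metric_space \<Rightarrow> real \<Rightarrow> ('a \<Rightarrow> real) \<Rightarrow> ('a \<Rightarrow> real) \<Rightarrow> 'a \<Rightarrow> real" where
  "glue x0 r f u = (\<lambda>y. if y \<in> ball x0 r then f y else u y)"

text \<open>Viscosity sub- and supersolutions of \<open>- I u + H(x, u, \<nabla>u) = 0\<close> in an open set \<open>\<Omega>\<close>.
  A function that is \<open>C\<^sup>2\<close> on the open ball may fail to be integrable near its boundary; then the
  glued function lies outside the domain of \<open>I\<close>, and such a pair of \<open>\<phi>\<close> and \<open>r\<close> is not a test.
  On any smaller ball the same \<open>\<phi>\<close> does give a test.\<close>

definition viscosity_subsolution ::
    "real \<Rightarrow> (('a::euclidean_space \<Rightarrow> real) \<Rightarrow> 'a \<Rightarrow> real) \<Rightarrow> ('a \<Rightarrow> real \<Rightarrow> 'a \<Rightarrow> real) \<Rightarrow>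
     'a set \<Rightarrow> ('a \<Rightarrow> real) \<Rightarrow> bool" where
  "viscosity_subsolution s I H \<Omega> u \<longleftrightarrow>
     u \<in> L1_weighted s \<and> usc_on (closure \<Omega>) u \<and>
     (\<forall>x0\<in>\<Omega>. \<forall>r>0. \<forall>\<phi>.
        C2_on \<phi> (ball x0 r) \<longrightarrow> u x0 = \<phi> x0 \<longrightarrow> (\<forall>y\<in>ball x0 r. u y \<le> \<phi> y) \<longrightarrow>
        glue x0 r \<phi> u \<in> L1_weighted s \<longrightarrow>
        - I (glue x0 r \<phi> u) x0 + H x0 (u x0) (grad \<phi> x0) \<le> 0)"

definition viscosity_supersolution ::
    "real \<Rightarrow> (('a::euclidean_space \<Rightarrow> real) \<Rightarrow> 'a \<Rightarrow> real) \<Rightarrow> ('a \<Rightarrow> real \<Rightarrow> 'a \<Rightarrow> real) \<Rightarrow>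
     'a set \<Rightarrow> ('a \<Rightarrow> real) \<Rightarrow> bool" where
  "viscosity_supersolution s I H \<Omega> u \<longleftrightarrow>
     u \<in> L1_weighted s \<and> lsc_on (closure \<Omega>) u \<and>
     (\<forall>x0\<in>\<Omega>. \<forall>r>0. \<forall>\<phi>.
        C2_on \<phi> (ball x0 r) \<longrightarrow> u x0 = \<phi> x0 \<longrightarrow> (\<forall>y\<in>ball x0 r. \<phi> y \<le> u y) \<longrightarrow>
        glue x0 r \<phi> u \<in> L1_weighted s \<longrightarrow>
        0 \<le> - I (glue x0 r \<phi> u) x0 + H x0 (u x0) (grad \<phi> x0))"

definition viscosity_solution ::
    "real \<Rightarrow> (('a::euclidean_space \<Rightarrow> real) \<Rightarrow> 'a \<Rightarrow> real) \<Rightarrow> ('a \<Rightarrow> real \<Rightarrow> 'a \<Rightarrow> real) \<Rightarrow>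
     'a set \<Rightarrow> ('a \<Rightarrow> real) \<Rightarrow> bool" where
  "viscosity_solution s I H \<Omega> u \<longleftrightarrow>
     viscosity_subsolution s I H \<Omega> u \<and> viscosity_supersolution s I H \<Omega> u"

end

theory Submission
  imports Defs
begin

text \<open>Doubling of variables with a concave power. Suppose
  \<open>u x - u y > L |x - y|^\<theta>\<close> for some pair and some \<open>L > 0\<close>, where \<open>\<theta> < 1\<close>. Then
  \<open>u x - u y - L |x - y|^\<theta> - \<epsilon> \<psi> x\<close> with \<open>\<psi> x = (1 + |x|^2)^(\<gamma>/2)\<close> has a maximum point \<open>(x, y)\<close>;
  put \<open>a = x - y \<noteq> 0\<close> and \<open>J = (1 + |x|^2)^(1/2)\<close>. Both test functions are used at once: increments
  \<open>z\<close> near \<open>a / 4\<close> see the strict concavity of \<open>t^\<theta>\<close>, all others cost at most the increment of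
  \<open>\<epsilon> \<psi>\<close>. Since the kernels are even, only second differences of \<open>\<psi>\<close> matter, and ellipticity yields
  \<open>c L |a|^(\<theta> - 2s) \<le> C \<epsilon> J^(\<gamma> - \<sigma>) + |H (p + q) - H p|\<close>, where \<open>|p| = L \<theta> |a|^(\<theta> - 1)\<close>,
  \<open>|q| \<le> \<epsilon> J^(\<gamma> - 1)\<close> and \<open>\<sigma> = 2s\<gamma> / \<theta> < 2s\<close>. The growth of \<open>u\<close> gives \<open>|a| \<le> C J^(\<gamma>/\<theta>)\<close>, and for
  \<open>\<gamma>\<close> below the critical exponent one can choose \<open>\<theta>\<close> so that, after division by \<open>|a|^(\<theta> - 2s)\<close>, the
  right-hand side is \<open>O(\<epsilon>)\<close> uniformly in \<open>J\<close>. This is absurd for small \<open>\<epsilon>\<close>. Hence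
  \<open>u x - u y \<le> L |x - y|^\<theta>\<close> for every \<open>L > 0\<close>, and \<open>u\<close> is constant.\<close>

section \<open>Lebesgue integrals of powers of the norm\<close>

text \<open>The affine change of variables with all scaling factors 1 has Jacobian 1; with factors
  -1, as in the reflection below, the determinant still has absolute value 1.\<close>

lemma distr_lebesgue_translation:
  "distr lebesgue lebesgue (\<lambda>x. h + x) = (lebesgue :: 'a::euclidean_space measure)"
    and measurable_lebesgue_translation:
  "(\<lambda>x. h + x) \<in> (lebesgue :: 'a::euclidean_space measure) \<rightarrow>\<^sub>M lebesgue"
proof -
  have T: "(\<lambda>x::'a. h + (\<Sum>j\<in>Basis. (1 * (x \<bullet> j)) *\<^sub>R j)) = (\<lambda>x. h + x)"
    by (simp add: euclidean_representation)
  show "distr lebesgue lebesgue (\<lambda>x. h + x) = (lebesgue :: 'a measure)"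
    using lebesgue_affine_euclidean[of "\<lambda>_. 1" h, unfolded T] by (simp add: density_1)
  show "(\<lambda>x. h + x) \<in> (lebesgue :: 'a measure) \<rightarrow>\<^sub>M lebesgue"
    using lebesgue_affine_measurable[of "\<lambda>_. 1" h, unfolded T] by simp
qed

lemma distr_lebesgue_uminus:
  "distr lebesgue lebesgue uminus = (lebesgue :: 'a::euclidean_space measure)"
    and measurable_lebesgue_uminus:
  "uminus \<in> (lebesgue :: 'a::euclidean_space measure) \<rightarrow>\<^sub>M lebesgue"
proof -
  have T: "(\<lambda>x::'a. 0 + (\<Sum>j\<in>Basis. ((-1) * (x \<bullet> j)) *\<^sub>R j)) = uminus"
    by (simp add: euclidean_representation sum_negf fun_eq_iff)
  show "distr lebesgue lebesgue uminus = (lebesgue :: 'a measure)"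
    using lebesgue_affine_euclidean[of "\<lambda>_. -1" "0::'a", unfolded T] by (simp add: density_1)
  show "uminus \<in> (lebesgue :: 'a measure) \<rightarrow>\<^sub>M lebesgue"
    using lebesgue_affine_measurable[of "\<lambda>_. -1" "0::'a", unfolded T] by simp
qed

lemma integrable_lebesgue_translation:
  fixes f :: "'a::euclidean_space \<Rightarrow> real"
  assumes "integrable lebesgue f"
  shows "integrable lebesgue (\<lambda>x. f (h + x))"
  using assms measurable_lebesgue_translation[of h] distr_lebesgue_translation[of h]
  by (metis integrable_distr)

lemma borel_measurable_lebesgue_translation:
  fixes f :: "'a::euclidean_space \<Rightarrow> real"
  assumes "f \<in> borel_measurable lebesgue"
  shows "(\<lambda>x. f (h + x)) \<in> borel_measurable lebesgue"
  using measurable_compose[OF measurable_lebesgue_translation assms] .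

lemma integrable_lebesgue_uminus:
  fixes f :: "'a::euclidean_space \<Rightarrow> real"
  assumes "integrable lebesgue f"
  shows "integrable lebesgue (\<lambda>x. f (- x))"
  using assms measurable_lebesgue_uminus distr_lebesgue_uminus
  by (metis integrable_distr)

lemma integral_lebesgue_uminus:
  fixes f :: "'a::euclidean_space \<Rightarrow> real"
  assumes "f \<in> borel_measurable lebesgue"
  shows "(LINT x|lebesgue. f (- x)) = (LINT x|lebesgue. f x)"
  using integral_distr[OF measurable_lebesgue_uminus assms] distr_lebesgue_uminus by metis

section \<open>Integrability of radial powers by dyadic layers\<close>

text \<open>The series of \<open>c k\<close> times the indicator of the ball of radius
  \<open>R k\<close> dominates \<open>f\<close>. That ball has volume a constant times
  \<open>R k ^ DIM('a)\<close>, so termwise integration gives a convergent series. The criterion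
  serves the singularity at 0 as well as the decay at infinity.\<close>

lemma integrable_dyadic_bound:
  fixes f :: "'a::euclidean_space \<Rightarrow> real"
  assumes meas: "f \<in> borel_measurable lebesgue" and nonneg: "\<And>z. 0 \<le> f z"
    and c: "\<And>k. 0 \<le> c k" and R: "\<And>k. 0 < R k"
    and bound: "\<And>z. f z \<noteq> 0 \<Longrightarrow> \<exists>k::nat. norm z < R k \<and> f z \<le> c k"
    and sum: "summable (\<lambda>k. c k * R k ^ DIM('a))"
  shows "integrable lebesgue f"
proof (rule integrableI_nonneg)
  let ?V = "unit_ball_vol (real DIM('a))"
  have sum': "summable (\<lambda>k. c k * (?V * R k ^ DIM('a)))"
    using summable_mult[OF sum, of ?V] by (simp add: mult_ac)
  have "(\<integral>\<^sup>+z. ennreal (f z) \<partial>lebesgue)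
      \<le> (\<integral>\<^sup>+(z::'a). (\<Sum>k. ennreal (c k) * indicator (ball 0 (R k)) z) \<partial>lebesgue)"
  proof (rule nn_integral_mono)
    fix z :: 'a
    show "ennreal (f z) \<le> (\<Sum>k. ennreal (c k) * indicator (ball 0 (R k)) z)"
    proof (cases "f z = 0")
      case False
      then obtain k where k: "norm z < R k" "f z \<le> c k"
        using bound by blast
      then have "ennreal (f z) \<le> (\<Sum>i\<in>{k}. ennreal (c i) * indicator (ball 0 (R i)) z)"
        by (simp add: ennreal_leI)
      also have "\<dots> \<le> (\<Sum>i. ennreal (c i) * indicator (ball 0 (R i)) z)"
        by (rule sum_le_suminf) auto
      finally show ?thesis .
    qed auto
  qed
  also have "\<dots> = (\<Sum>k. \<integral>\<^sup>+z. ennreal (c k) * indicator (ball (0::'a) (R k)) z \<partial>lebesgue)"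
    by (intro nn_integral_suminf borel_measurable_times_ennreal
        borel_measurable_const borel_measurable_indicator) auto
  also have "\<dots> = (\<Sum>k. ennreal (c k * (?V * R k ^ DIM('a))))"
  proof (intro suminf_cong)
    fix k
    have "(\<integral>\<^sup>+z. ennreal (c k) * indicator (ball (0::'a) (R k)) z \<partial>lebesgue)
        = ennreal (c k) * emeasure lborel (ball (0::'a) (R k))"
      by (subst nn_integral_cmult_indicator) auto
    also have "\<dots> = ennreal (c k * (?V * R k ^ DIM('a)))"
      using R[of k] c[of k] by (simp add: emeasure_ball ennreal_mult)
    finally show "(\<integral>\<^sup>+z. ennreal (c k) * indicator (ball (0::'a) (R k)) z \<partial>lebesgue)
        = ennreal (c k * (?V * R k ^ DIM('a)))" .
  qed
  also have "\<dots> = ennreal (\<Sum>k. c k * (?V * R k ^ DIM('a)))"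
    using c R by (intro suminf_ennreal2 sum') (auto intro!: mult_nonneg_nonneg simp: less_imp_le)
  also have "\<dots> < \<infinity>" by simp
  finally show "(\<integral>\<^sup>+z. ennreal (f z) \<partial>lebesgue) < \<infinity>" .
qed (use meas nonneg in auto)

lemma dyadic_bracket:
  fixes r :: real
  assumes "0 < r"
  obtains j :: int where "2 powr j \<le> r" "r < 2 powr (j + 1)"
proof
  have "2 powr real_of_int \<lfloor>log 2 r\<rfloor> \<le> 2 powr (log 2 r)" by (intro powr_mono) auto
  then show "2 powr real_of_int \<lfloor>log 2 r\<rfloor> \<le> r" using assms by simp
  have "2 powr (log 2 r) < 2 powr (real_of_int \<lfloor>log 2 r\<rfloor> + 1)" by (intro powr_less_mono) auto
  then show "r < 2 powr real_of_int (\<lfloor>log 2 r\<rfloor> + 1)" using assms by simp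
qed

text \<open>The sign of \<open>e\<close> decides which end of the bracket bounds the power; the
  factor \<open>2 powr \<bar>e\<bar>\<close> covers both cases.\<close>

lemma powr_dyadic_bound:
  fixes r e :: real
  assumes "2 powr j \<le> r" "r < 2 powr (j + 1)"
  shows "r powr e \<le> 2 powr \<bar>e\<bar> * 2 powr (j * e)"
proof (cases "0 \<le> e")
  case True
  have "r powr e \<le> (2 powr (j + 1)) powr e"
    using assms True order.trans[OF powr_ge_zero assms(1)] by (intro powr_mono2) auto
  also have "\<dots> = 2 powr \<bar>e\<bar> * 2 powr (j * e)"
    using True by (simp add: powr_powr powr_add[symmetric] algebra_simps)
  finally show ?thesis .
next
  case False
  have "0 < (2::real) powr j" by simp
  then have "r powr e \<le> (2 powr j) powr e"
    using assms False by (intro powr_mono2') auto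
  also have "\<dots> = 2 powr (j * e)" by (simp add: powr_powr)
  also have "\<dots> \<le> 2 powr \<bar>e\<bar> * 2 powr (j * e)"
    using ge_one_powr_ge_zero[of 2 "\<bar>e\<bar>"] by simp
  finally show ?thesis .
qed

text \<open>Layer \<open>k\<close> is 2^(-k-1) \<le> |z| < 2^(-k): \<open>c k\<close> bounds the
  power on it and \<open>R k\<close> is its outer radius. The products with the volumes form a
  geometric series of ratio 2^(-a) < 1.\<close>

lemma powr_norm_integrable_unit_ball:
  assumes "0 < a"
  shows "integrable lebesgue
    (\<lambda>z::'a::euclidean_space. indicator (ball 0 1) z * norm z powr (a - real DIM('a)))"
proof (rule integrable_dyadic_bound)
  let ?e = "a - real DIM('a)"
  let ?c = "\<lambda>k::nat. 2 powr \<bar>?e\<bar> * 2 powr (- (real k + 1) * ?e)"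
  let ?R = "\<lambda>k::nat. 2 powr (- real k)"
  show "(\<lambda>z::'a. indicator (ball 0 1) z * norm z powr ?e) \<in> borel_measurable lebesgue"
    by (intro borel_measurable_times borel_measurable_indicator measurable_completion) auto
  show "0 \<le> ?c k" "0 < ?R k" for k by auto
  show "\<exists>k. norm z < ?R k \<and> indicator (ball 0 1) z * norm z powr ?e \<le> ?c k"
    if "indicator (ball 0 1) z * norm z powr ?e \<noteq> 0" for z :: 'a
  proof -
    \<comment> \<open>Since \<open>0 powr x = 0\<close>, the integrand vanishes at the origin, which
      lies in no layer.\<close>
    from that have z: "norm z < 1" "0 < norm z" by (auto simp: indicator_def split: if_splits)
    obtain j :: int where j: "2 powr j \<le> norm z" "norm z < 2 powr (j + 1)"
      using dyadic_bracket[OF z(2)] by metis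
    have "2 powr j < 2 powr (0::real)" using j z by simp
    then have "j < 0" by (subst (asm) powr_less_cancel_iff) auto
    define k where "k = nat (- j - 1)"
    have k: "real_of_int j = - (real k + 1)" using \<open>j < 0\<close> by (simp add: k_def)
    show ?thesis
      using z j powr_dyadic_bound[of j "norm z" ?e] by (intro exI[of _ k]) (simp add: k)
  qed
  have "?c k * ?R k ^ DIM('a) = 2 powr (\<bar>?e\<bar> - ?e) * (2 powr (- a)) ^ k" for k
  proof -
    have "?c k * ?R k ^ DIM('a) = 2 powr (\<bar>?e\<bar> + - (real k + 1) * ?e + - real k * DIM('a))"
      by (simp only: powr_power powr_add[symmetric] mult.assoc) (simp add: algebra_simps)
    also have "\<dots> = 2 powr ((\<bar>?e\<bar> - ?e) + - a * real k)"
      by (intro arg_cong[of _ _ "(powr) 2"]) (simp add: algebra_simps)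
    also have "\<dots> = 2 powr (\<bar>?e\<bar> - ?e) * (2 powr (- a)) ^ k"
      by (simp only: powr_realpow[symmetric] powr_powr powr_add zero_less_numeral powr_gt_zero)
    finally show ?thesis .
  qed
  moreover have "summable (\<lambda>k. 2 powr (\<bar>?e\<bar> - ?e) * (2 powr (- a)) ^ k)"
    using assms by (intro summable_mult summable_geometric) (simp add: powr_less_one)
  ultimately show "summable (\<lambda>k. ?c k * ?R k ^ DIM('a))" by simp
qed auto

text \<open>The layers are now 2^k \<le> |z| < 2^(k+1), and the ratio 2^a is below 1 because
  \<open>a\<close> is negative.\<close>

lemma powr_norm_integrable_outside_unit_ball:
  assumes "a < 0"
  shows "integrable lebesgue
    (\<lambda>z::'a::euclidean_space. indicator (- ball 0 1) z * norm z powr (a - real DIM('a)))"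
proof (rule integrable_dyadic_bound)
  let ?e = "a - real DIM('a)"
  let ?c = "\<lambda>k::nat. 2 powr \<bar>?e\<bar> * 2 powr (real k * ?e)"
  let ?R = "\<lambda>k::nat. 2 powr (real k + 1)"
  show "(\<lambda>z::'a. indicator (- ball 0 1) z * norm z powr ?e) \<in> borel_measurable lebesgue"
    by (intro borel_measurable_times borel_measurable_indicator measurable_completion) auto
  show "0 \<le> ?c k" "0 < ?R k" for k by auto
  show "\<exists>k. norm z < ?R k \<and> indicator (- ball 0 1) z * norm z powr ?e \<le> ?c k"
    if "indicator (- ball 0 1) z * norm z powr ?e \<noteq> 0" for z :: 'a
  proof -
    from that have z: "1 \<le> norm z" by (auto simp: indicator_def split: if_splits)
    obtain j :: int where j: "2 powr j \<le> norm z" "norm z < 2 powr (j + 1)"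
      using dyadic_bracket[OF less_le_trans[OF zero_less_one z]] by metis
    have "2 powr (0::real) < 2 powr (real_of_int j + 1)" using j z by simp
    then have "0 \<le> j" by (subst (asm) powr_less_cancel_iff) auto
    define k where "k = nat j"
    have k: "real_of_int j = real k" using \<open>0 \<le> j\<close> by (simp add: k_def)
    show ?thesis
      using z j powr_dyadic_bound[of j "norm z" ?e] by (intro exI[of _ k]) (simp add: k)
  qed
  have "?c k * ?R k ^ DIM('a) = 2 powr (\<bar>?e\<bar> + DIM('a)) * (2 powr a) ^ k" for k
  proof -
    have "?c k * ?R k ^ DIM('a) = 2 powr (\<bar>?e\<bar> + real k * ?e + (real k + 1) * DIM('a))"
      by (simp only: powr_power powr_add[symmetric] mult.assoc) (simp add: algebra_simps)
    also have "\<dots> = 2 powr ((\<bar>?e\<bar> + DIM('a)) + a * real k)"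
      by (intro arg_cong[of _ _ "(powr) 2"]) (simp add: algebra_simps)
    also have "\<dots> = 2 powr (\<bar>?e\<bar> + DIM('a)) * (2 powr a) ^ k"
      by (simp only: powr_realpow[symmetric] powr_powr powr_add zero_less_numeral powr_gt_zero)
    finally show ?thesis .
  qed
  moreover have "summable (\<lambda>k. 2 powr (\<bar>?e\<bar> + DIM('a)) * (2 powr a) ^ k)"
    using assms by (intro summable_mult summable_geometric) (simp add: powr_less_one)
  ultimately show "summable (\<lambda>k. ?c k * ?R k ^ DIM('a))" by simp
qed auto

section \<open>Integrability of the nonlocal integrand\<close>

lemma one_plus_norm_pos: "0 < 1 + norm z"
  using norm_ge_zero[of z] by linarith

lemma weight_pos: "0 < weight s z"
  using one_plus_norm_pos[of z] by (simp add: weight_def)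

lemma weight_borel_measurable: "weight s \<in> borel_measurable lebesgue"
proof -
  have "weight s \<in> borel_measurable borel" unfolding weight_def by measurable
  then show ?thesis by (intro measurable_completion) simp
qed

text \<open>This is 1 + |h + z| \<le> (1 + |h|) (1 + |z|) raised to a negative power. It makes the
  weighted space invariant under translations.\<close>

lemma weight_translation_le:
  fixes z h :: "'a::euclidean_space"
  assumes "0 \<le> s"
  shows "weight s z \<le> (1 + norm h) powr (real DIM('a) + 2 * s) * weight s (h + z)"
proof -
  let ?e = "real DIM('a) + 2 * s"
  have "1 + norm (h + z) \<le> (1 + norm h) * (1 + norm z)"
    using norm_triangle_ineq[of h z] mult_nonneg_nonneg[OF norm_ge_zero[of h] norm_ge_zero[of z]]
    unfolding ring_distribs by linarith
  then have "((1 + norm h) * (1 + norm z)) powr - ?e \<le> (1 + norm (h + z)) powr - ?e"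
    using assms one_plus_norm_pos[of h] one_plus_norm_pos[of z] one_plus_norm_pos[of "h + z"]
    by (intro powr_mono2') auto
  then have "(1 + norm h) powr ?e * ((1 + norm h) powr - ?e * (1 + norm z) powr - ?e)
      \<le> (1 + norm h) powr ?e * (1 + norm (h + z)) powr - ?e"
    using one_plus_norm_pos[of h] one_plus_norm_pos[of z]
    by (subst powr_mult[symmetric]) (auto intro!: mult_left_mono)
  then have "(1 + norm h) powr (?e + - ?e) * (1 + norm z) powr - ?e
      \<le> (1 + norm h) powr ?e * (1 + norm (h + z)) powr - ?e"
    by (simp only: powr_add mult.assoc)
  moreover have "1 + norm h \<noteq> 0" using norm_ge_zero[of h] by linarith
  ultimately show ?thesis by (simp add: weight_def)
qed

lemma L1_weighted_borel_measurable:
  assumes "u \<in> L1_weighted s"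
  shows "u \<in> borel_measurable lebesgue"
proof -
  have "(\<lambda>z. u z * weight s z / weight s z) \<in> borel_measurable lebesgue"
    using assms weight_borel_measurable unfolding L1_weighted_def
    by (intro borel_measurable_divide) auto
  moreover have "(\<lambda>z. u z * weight s z / weight s z) = u"
    using less_imp_neq[OF weight_pos] by (fastforce simp: fun_eq_iff)
  ultimately show ?thesis by simp
qed

lemma L1_weighted_translation:
  fixes u :: "'a::euclidean_space \<Rightarrow> real"
  assumes "u \<in> L1_weighted s" "0 \<le> s"
  shows "(\<lambda>z. u (h + z)) \<in> L1_weighted s"
proof -
  let ?C = "(1 + norm h) powr (real DIM('a) + 2 * s)"
  have int: "integrable lebesgue (\<lambda>z. ?C * (u (h + z) * weight s (h + z)))"
    using assms integrable_lebesgue_translation[of "\<lambda>z. u z * weight s z" h]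
    by (simp add: L1_weighted_def)
  have "integrable lebesgue (\<lambda>z. u (h + z) * weight s z)"
  proof (rule Bochner_Integration.integrable_bound[OF int])
    show "(\<lambda>z. u (h + z) * weight s z) \<in> borel_measurable lebesgue"
      using borel_measurable_lebesgue_translation[OF L1_weighted_borel_measurable[OF assms(1)]]
        weight_borel_measurable by (intro borel_measurable_times)
    have "\<bar>u (h + z) * weight s z\<bar> \<le> \<bar>?C * (u (h + z) * weight s (h + z))\<bar>" for z
      using mult_left_mono[OF weight_translation_le[OF assms(2), of z h] abs_ge_zero[of "u (h + z)"]]
      by (simp add: abs_mult abs_of_pos[OF weight_pos] mult_ac)
    then show "AE z in lebesgue. norm (u (h + z) * weight s z)
        \<le> norm (?C * (u (h + z) * weight s (h + z)))"
      by simp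
  qed
  then show ?thesis by (simp add: L1_weighted_def)
qed

lemma weight_integrable:
  assumes "0 < s"
  shows "integrable lebesgue (weight s :: 'a::euclidean_space \<Rightarrow> real)"
proof -
  let ?f = "\<lambda>z::'a. indicator (ball 0 1) z
    + indicator (- ball 0 1) z * norm z powr (- 2 * s - real DIM('a))"
  have int: "integrable lebesgue ?f"
    using assms by (intro Bochner_Integration.integrable_add powr_norm_integrable_outside_unit_ball)
      (use emeasure_lborel_ball_finite[of "0::'a" 1] in \<open>auto intro!: integrable_real_indicator\<close>)
  show ?thesis
  proof (rule Bochner_Integration.integrable_bound[OF int weight_borel_measurable])
    have le: "weight s z \<le> ?f z" for z :: 'a
    proof (cases "z \<in> ball 0 1")
      case True
      have "(1 + norm z) powr (- real DIM('a) - 2 * s) \<le> 1 powr (- real DIM('a) - 2 * s)"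
        using assms by (intro powr_mono2') auto
      with True show ?thesis by (simp add: weight_def)
    next
      case False
      then have "0 < norm z" by auto
      then have "(1 + norm z) powr (- real DIM('a) - 2 * s) \<le> norm z powr (- real DIM('a) - 2 * s)"
        using assms by (intro powr_mono2') auto
      then show ?thesis using False by (simp add: weight_def minus_diff_commute)
    qed
    have "norm (weight s z) \<le> norm (?f z)" for z :: 'a
      using le[of z] weight_pos[of s z] unfolding real_norm_def by linarith
    then show "AE z in lebesgue. norm (weight s z :: real) \<le> norm (?f z)"
      by (intro always_eventually allI)
  qed
qed

text \<open>For |z| \<ge> \<delta>, 1 + |z| is at most (1 + \<delta>)/\<delta> times |z|. Thus the
  weight dominates the tail of every kernel, and weighted integrability controls the nonlocal
  integral far out.\<close>

lemma kernel_le_weight: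
  fixes z :: "'a::euclidean_space"
  assumes "0 < \<delta>" "\<delta> \<le> norm z" "0 \<le> s"
  shows "norm z powr (- real DIM('a) - 2 * s)
    \<le> ((1 + \<delta>) / \<delta>) powr (real DIM('a) + 2 * s) * weight s z"
proof -
  let ?e = "real DIM('a) + 2 * s"
  let ?q = "(1 + \<delta>) / \<delta>"
  have "1 + norm z \<le> ?q * norm z" using assms by (simp add: field_simps)
  then have "(?q * norm z) powr - ?e \<le> (1 + norm z) powr - ?e"
    using assms one_plus_norm_pos[of z]
    by (intro powr_mono2') auto
  then have "?q powr ?e * (?q powr - ?e * norm z powr - ?e) \<le> ?q powr ?e * (1 + norm z) powr - ?e"
    using assms by (subst powr_mult[symmetric]) (auto intro!: mult_left_mono)
  then have "?q powr (?e + - ?e) * norm z powr - ?e \<le> ?q powr ?e * (1 + norm z) powr - ?e"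
    by (simp only: powr_add mult.assoc)
  moreover have "?q \<noteq> 0" using assms by auto
  ultimately show ?thesis by (simp add: weight_def)
qed

section \<open>Gradients and pointwise expansions\<close>

lemma gderiv_unique:
  assumes "GDERIV f x :> D" "GDERIV f x :> E"
  shows "D = E"
proof -
  have "(\<lambda>h. h \<bullet> D) = (\<lambda>h. h \<bullet> E)"
    using assms unfolding gderiv_def by (rule has_derivative_unique)
  then have "(D - E) \<bullet> D = (D - E) \<bullet> E" by meson
  then have "(D - E) \<bullet> (D - E) = 0" by (simp add: inner_diff_right)
  then show ?thesis by simp
qed

lemma grad_eq: "GDERIV f x :> D \<Longrightarrow> grad f x = D"
  unfolding grad_def using gderiv_unique by blast

lemma gderiv_translation:
  assumes "GDERIV f (h + x) :> D"
  shows "GDERIV (\<lambda>y. f (h + y)) x :> D"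
proof -
  have "((\<lambda>y. h + y) has_derivative (\<lambda>k. k)) (at x)"
    by (auto intro!: derivative_eq_intros)
  from has_derivative_compose[OF this assms[unfolded gderiv_def]] show ?thesis
    by (simp add: gderiv_def)
qed

lemma C11_at_gderiv:
  fixes u :: "'a::euclidean_space \<Rightarrow> real"
  assumes "0 < r" and exp: "\<And>h. norm h < r \<Longrightarrow> \<bar>u (x + h) - u x - p \<bullet> h\<bar> \<le> C * (norm h)\<^sup>2"
  shows "GDERIV u x :> p"
  unfolding gderiv_def has_derivative_at
proof
  show "bounded_linear (\<lambda>h. h \<bullet> p)" by (rule bounded_linear_inner_left)
  show "(\<lambda>h. norm (u (x + h) - u x - h \<bullet> p) / norm h) \<midarrow>0\<rightarrow> 0"
  proof (rule Lim_null_comparison)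
    show "\<forall>\<^sub>F h in at 0. norm (norm (u (x + h) - u x - h \<bullet> p) / norm h) \<le> C * norm h"
      unfolding eventually_at
    proof (intro exI[of _ r] conjI ballI impI)
      fix h :: 'a assume "h \<noteq> 0 \<and> dist h 0 < r"
      then show "norm (norm (u (x + h) - u x - h \<bullet> p) / norm h) \<le> C * norm h"
        using exp[of h] by (simp add: field_simps power2_eq_square inner_commute)
    qed fact
    show "((\<lambda>h::'a. C * norm h) \<longlongrightarrow> 0) (at 0)"
      by (auto intro!: tendsto_eq_intros)
  qed
qed

text \<open>Identifies the slope in \<open>C11_at\<close> with \<open>grad\<close>, the vector that
  enters the nonlocal operator, and makes the constant nonnegative by passing to
  \<open>max C 0\<close>.\<close>

lemma C11_at_expansion:
  assumes "C11_at u x"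
  obtains C r where "0 < r" "0 \<le> C"
    "\<And>h. norm h < r \<Longrightarrow> \<bar>u (x + h) - u x - grad u x \<bullet> h\<bar> \<le> C * (norm h)\<^sup>2"
proof -
  obtain p C r where *: "0 < r"
      "\<And>h. norm h < r \<Longrightarrow> \<bar>u (x + h) - u x - p \<bullet> h\<bar> \<le> C * (norm h)\<^sup>2"
    using assms unfolding C11_at_def by blast
  have "grad u x = p" using grad_eq[OF C11_at_gderiv[OF *]] .
  moreover have "C * (norm h)\<^sup>2 \<le> max C 0 * (norm h)\<^sup>2" for h :: 'a
    by (intro mult_right_mono) auto
  ultimately have "\<bar>u (x + h) - u x - grad u x \<bullet> h\<bar> \<le> max C 0 * (norm h)\<^sup>2" if "norm h < r" for h
    using *(2)[OF that] by (simp add: order_trans)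
  then show ?thesis using that[of r "max C 0"] *(1) by simp
qed

lemma admissible_translation:
  assumes "admissible s u x" "0 \<le> s"
  shows "admissible s (\<lambda>z. u (x + z)) 0"
  using assms L1_weighted_translation[of u s x] by (simp add: admissible_def C11_at_def)

section \<open>Symmetric kernels and the integrand at the origin\<close>

lemma K_sym_bounds:
  fixes K :: "'a::euclidean_space \<Rightarrow> real"
  assumes "K \<in> K_sym s lam Lam" "z \<noteq> 0"
  shows "0 \<le> K z" "lam * norm z powr (- real DIM('a) - 2 * s) \<le> K z"
    "K z \<le> Lam * norm z powr (- real DIM('a) - 2 * s)" "K (- z) = K z"
proof -
  have e: "norm z powr (- real DIM('a) - 2 * s) = inverse (norm z powr (real DIM('a) + 2 * s))"
    using powr_minus[of "norm z" "real DIM('a) + 2 * s"] by simp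
  have "0 \<le> K z \<and> lam / norm z powr (real DIM('a) + 2 * s) \<le> K z \<and>
      K z \<le> Lam / norm z powr (real DIM('a) + 2 * s)"
    using assms unfolding K_sym_def by blast
  then show "0 \<le> K z" "lam * norm z powr (- real DIM('a) - 2 * s) \<le> K z"
    "K z \<le> Lam * norm z powr (- real DIM('a) - 2 * s)"
    unfolding e divide_inverse by blast+
  have "K z = K (- z)" using assms unfolding K_sym_def by blast
  then show "K (- z) = K z" by (rule sym)
qed

lemma K_sym_nonempty:
  assumes "lam \<le> Lam" "0 \<le> lam"
  shows "(\<lambda>z::'a::euclidean_space. lam * norm z powr (- real DIM('a) - 2 * s)) \<in> K_sym s lam Lam"
proof -
  have "(\<lambda>z::'a. lam * norm z powr (- real DIM('a) - 2 * s)) \<in> borel_measurable lborel"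
    by measurable
  moreover have "norm z powr (- real DIM('a) - 2 * s) = inverse (norm z powr (real DIM('a) + 2 * s))"
    for z :: 'a using powr_minus[of "norm z" "real DIM('a) + 2 * s"] by simp
  ultimately show ?thesis
    using assms unfolding K_sym_def divide_inverse
    by (intro CollectI) (auto simp: measurable_completion intro!: mult_right_mono)
qed

text \<open>Translation invariance will move every evaluation to the origin. The factor
  \<open>indicator {1..<2} (2 * s)\<close> equals 1 for 1/2 < s < 1 and is therefore left
  out.\<close>

definition L_integrand :: "('a::euclidean_space \<Rightarrow> real) \<Rightarrow> 'a \<Rightarrow> real" where
  "L_integrand f z = f z - f 0 - indicator (ball 0 1) z * (grad f 0 \<bullet> z)"

lemma nonlocal_L_at_0:
  assumes "1 / 2 < s" "s < 1"
  shows "nonlocal_L s K f 0 = (LINT z|lebesgue. L_integrand f z * K z)"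
  using assms by (simp add: nonlocal_L_def L_integrand_def)

text \<open>Near 0 the quadratic remainder times the kernel is O(|z|^(2 - 2s - n)), integrable as s
  < 1. Away from 0 the kernel is at most a multiple of the weight, against which \<open>f\<close>
  and constants are integrable.\<close>

lemma L_integrand_integrable:
  fixes f :: "'a::euclidean_space \<Rightarrow> real"
  assumes f: "admissible s f 0" and K: "K \<in> K_sym s lam Lam" and s: "0 < s" "s < 1" and Lam: "0 \<le> Lam"
  shows "integrable lebesgue (\<lambda>z. L_integrand f z * K z)"
proof -
  let ?e = "- real DIM('a) - 2 * s"
  define p where "p = grad f 0"
  have "C11_at f 0" using f by (simp add: admissible_def)
  then obtain C r where r: "0 < r" and C: "0 \<le> C"
    and exp': "\<And>h. norm h < r \<Longrightarrow> \<bar>f (0 + h) - f 0 - grad f 0 \<bullet> h\<bar> \<le> C * (norm h)\<^sup>2"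
    by (rule C11_at_expansion) blast
  have exp: "\<bar>f h - f 0 - p \<bullet> h\<bar> \<le> C * (norm h)\<^sup>2" if "norm h < r" for h
    using exp'[OF that] by (simp add: p_def)
  \<comment> \<open>The bound \<delta> \<le> 1 places the ball of radius \<delta> inside the unit
    ball, where the integrand contains the gradient term that the expansion needs.\<close>
  define \<delta> where "\<delta> = min r 1"
  have \<delta>: "0 < \<delta>" "\<delta> \<le> 1" "\<delta> \<le> r" using r by (auto simp: \<delta>_def)
  define Q where "Q = ((1 + \<delta>) / \<delta>) powr (real DIM('a) + 2 * s)"
  \<comment> \<open>\<open>b\<close> bounds \<open>f 0\<close> together with the gradient term,
    which is cut off outside the unit ball.\<close>
  define b where "b = \<bar>f 0\<bar> + norm p"
  let ?g = "\<lambda>z. C * Lam * (indicator (ball 0 1) z * norm z powr ((2 - 2 * s) - real DIM('a)))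
      + Lam * Q * (\<bar>f z * weight s z\<bar> + b * weight s z)"
  have L1: "integrable lebesgue (\<lambda>z. f z * weight s z)"
    using f by (simp add: admissible_def L1_weighted_def)
  have int: "integrable lebesgue ?g"
    using L1 weight_integrable[OF s(1)] powr_norm_integrable_unit_ball[of "2 - 2 * s"] s
    by (intro Bochner_Integration.integrable_add integrable_mult_right integrable_abs) auto
  have nonneg: "0 \<le> Q" "0 \<le> b" by (auto simp: Q_def b_def)
  show ?thesis
  proof (rule Bochner_Integration.integrable_bound[OF int])
    have "(\<lambda>z. indicator (ball 0 1) z * (p \<bullet> z)) \<in> borel_measurable lborel"
      by (intro borel_measurable_times borel_measurable_indicator) auto
    then have 1: "(\<lambda>z. indicator (ball 0 1) z * (p \<bullet> z)) \<in> borel_measurable lebesgue"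
      by (rule measurable_completion)
    have 2: "f \<in> borel_measurable lebesgue"
      using f L1_weighted_borel_measurable by (auto simp: admissible_def)
    have 3: "K \<in> borel_measurable lebesgue" using K unfolding K_sym_def by blast
    show "(\<lambda>z. L_integrand f z * K z) \<in> borel_measurable lebesgue"
      unfolding L_integrand_def p_def[symmetric]
      by (intro borel_measurable_times[OF _ 3] borel_measurable_diff[OF _ 1]
          borel_measurable_diff[OF 2] borel_measurable_const)
    have "\<bar>L_integrand f z * K z\<bar> \<le> ?g z" for z
    proof (cases "z = 0")
      case True
      have "0 \<le> ?g z"
        using C Lam nonneg weight_pos[of s z] by (intro add_nonneg_nonneg mult_nonneg_nonneg) auto
      then show ?thesis by (simp add: True L_integrand_def)
    next
      case z: False
      note Kz = K_sym_bounds[OF K z]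
      show ?thesis
      proof (cases "norm z < \<delta>")
        case True
        then have "\<bar>L_integrand f z\<bar> \<le> C * (norm z)\<^sup>2"
          using exp[of z] \<delta> by (auto simp: L_integrand_def p_def)
        then have "\<bar>L_integrand f z * K z\<bar> \<le> C * (norm z)\<^sup>2 * (Lam * norm z powr ?e)"
          unfolding abs_mult using Kz C by (intro mult_mono) auto
        also have "\<dots> = C * Lam * (norm z powr (2 + ?e))"
          using z unfolding powr_add by simp
        also have "\<dots> \<le> ?g z"
          using True \<delta> Lam nonneg weight_pos[of s z]
          by (auto simp: less_imp_le algebra_simps intro!: add_nonneg_nonneg mult_nonneg_nonneg)
        finally show ?thesis .
      next
        case False
        have "\<bar>indicator (ball 0 1) z * (p \<bullet> z)\<bar> \<le> norm p"
          using Cauchy_Schwarz_ineq2[of p z] mult_left_le[of "norm z" "norm p"]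
          by (auto simp: indicator_def abs_mult)
        then have "\<bar>L_integrand f z\<bar> \<le> \<bar>f z\<bar> + b"
          unfolding L_integrand_def b_def p_def by linarith
        then have "\<bar>L_integrand f z * K z\<bar> \<le> (\<bar>f z\<bar> + b) * (Lam * norm z powr ?e)"
          unfolding abs_mult using Kz nonneg by (intro mult_mono) auto
        also have "\<dots> \<le> (\<bar>f z\<bar> + b) * (Lam * (Q * weight s z))"
          using False \<delta> s Lam nonneg kernel_le_weight[of \<delta> z s]
          by (intro mult_left_mono) (auto simp: Q_def)
        also have "\<dots> = Lam * Q * (\<bar>f z * weight s z\<bar> + b * weight s z)"
          using weight_pos[of s z] by (simp add: abs_mult algebra_simps)
        also have "\<dots> \<le> ?g z" using C Lam by simp
        finally show ?thesis .
      qed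
    qed
    then show "AE z in lebesgue. norm (L_integrand f z * K z) \<le> norm (?g z)"
      by (intro always_eventually) (metis real_norm_def abs_ge_self order_trans)
  qed
qed

section \<open>Test functions\<close>

text \<open>Young's inequality with weights \<kappa> and 1 - \<kappa>, multiplied by
  \<open>t powr (\<kappa> - 1)\<close>. The point \<open>t'\<close> may be 0, so the tangent bound
  reaches the zero of the norm.\<close>

lemma powr_le_tangent:
  fixes t t' \<kappa> :: real
  assumes "0 < t" "0 \<le> t'" "0 < \<kappa>" "\<kappa> < 1"
  shows "t' powr \<kappa> \<le> t powr \<kappa> + \<kappa> * t powr (\<kappa> - 1) * (t' - t)"
proof -
  have "t' powr \<kappa> * t powr (1 - \<kappa>) \<le> \<kappa> * t' + (1 - \<kappa>) * t"
    using assms Youngs_inequality_0[of \<kappa> "1 - \<kappa>" t' t] by (cases "t' = 0") auto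
  then have "t' powr \<kappa> * t powr (1 - \<kappa>) * t powr (\<kappa> - 1) \<le> (\<kappa> * t' + (1 - \<kappa>) * t) * t powr (\<kappa> - 1)"
    by (rule mult_right_mono) simp
  moreover have "t powr (1 - \<kappa>) * t powr (\<kappa> - 1) = 1"
    using assms by (simp flip: powr_add)
  moreover have "t * t powr (\<kappa> - 1) = t powr \<kappa>"
    using assms powr_add[of t 1 "\<kappa> - 1"] by simp
  ultimately show ?thesis by (simp add: algebra_simps)
qed

text \<open>Write (a + b)^e as a (a + b)^(e-1) + b (a + b)^(e-1); the power with exponent e - 1
  \<le> 0 is nonincreasing.\<close>

lemma powr_add_le_add_powr:
  fixes a b e :: real
  assumes "0 \<le> a" "0 \<le> b" "e \<le> 1"
  shows "(a + b) powr e \<le> a powr e + b powr e"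
proof (cases "a = 0 \<or> b = 0")
  case True then show ?thesis using assms by auto
next
  case False
  then have pos: "0 < a" "0 < b" using assms by auto
  have "(a + b) powr e = a * (a + b) powr (e - 1) + b * (a + b) powr (e - 1)"
    using pos powr_add[of "a + b" 1 "e - 1"] by (simp add: algebra_simps)
  also have "\<dots> \<le> a * a powr (e - 1) + b * b powr (e - 1)"
    using pos assms by (intro add_mono mult_left_mono powr_mono2') auto
  also have "\<dots> = a powr e + b powr e"
    using pos powr_add[of a 1 "e - 1"] powr_add[of b 1 "e - 1"] by simp
  finally show ?thesis .
qed

section \<open>Radial powers and regularity of test functions\<close>

text \<open>One family for both test functions: \<open>c = 0\<close>, \<kappa> = \<theta>/2 gives
  |x|^\<theta>, and \<open>c = 1\<close>, \<kappa> = \<gamma>/2 gives the penalty \<psi>.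
  Derivatives stay in the family with \<kappa> lowered by 1.\<close>

definition radial :: "real \<Rightarrow> real \<Rightarrow> 'a::euclidean_space \<Rightarrow> real" where
  "radial c \<kappa> x = (c + x \<bullet> x) powr \<kappa>"

lemma radial_0: "radial 0 (e / 2) x = norm x powr e"
  by (simp add: radial_def powr_powr power2_norm_eq_inner[symmetric] powr_numeral[symmetric] del: powr_numeral)

lemma radial_minus: "radial c \<kappa> (- x) = radial c \<kappa> x"
  by (simp add: radial_def)

text \<open>The tangent inequality in the variable t = c + |x|^2: the first-order parts 2 x
  \<bullet> z and -2 x \<bullet> z cancel and 2 |z|^2 remains. No restriction on \<open>z\<close>
  arises, even when the segment meets the kink of the case \<open>c = 0\<close>.\<close>

lemma radial_second_difference_le:
  fixes x z :: "'a::euclidean_space"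
  assumes "0 < c + x \<bullet> x" "0 \<le> c" "0 < \<kappa>" "\<kappa> < 1"
  shows "radial c \<kappa> (x + z) + radial c \<kappa> (x - z) - 2 * radial c \<kappa> x
    \<le> 2 * \<kappa> * radial c (\<kappa> - 1) x * (z \<bullet> z)"
proof -
  have "radial c \<kappa> (x + z) \<le> radial c \<kappa> x
      + \<kappa> * radial c (\<kappa> - 1) x * ((c + (x + z) \<bullet> (x + z)) - (c + x \<bullet> x))"
    "radial c \<kappa> (x - z) \<le> radial c \<kappa> x
      + \<kappa> * radial c (\<kappa> - 1) x * ((c + (x - z) \<bullet> (x - z)) - (c + x \<bullet> x))"
    unfolding radial_def using assms
    by (simp_all only: powr_le_tangent add_nonneg_nonneg inner_ge_zero)
  then have "radial c \<kappa> (x + z) + radial c \<kappa> (x - z) - 2 * radial c \<kappa> x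
    \<le> \<kappa> * radial c (\<kappa> - 1) x * (((x + z) \<bullet> (x + z) - x \<bullet> x) + ((x - z) \<bullet> (x - z) - x \<bullet> x))"
    by (simp add: algebra_simps)
  also have "((x + z) \<bullet> (x + z) - x \<bullet> x) + ((x - z) \<bullet> (x - z) - x \<bullet> x) = 2 * (z \<bullet> z)"
    by (simp add: inner_diff_left inner_diff_right inner_add_left inner_add_right)
  finally show ?thesis by (simp add: mult_ac)
qed

lemma gderiv_radial:
  fixes x :: "'a::euclidean_space"
  assumes "0 < c + x \<bullet> x"
  shows "GDERIV (radial c \<kappa>) x :> (2 * \<kappa> * radial c (\<kappa> - 1) x) *\<^sub>R x"
  unfolding gderiv_def radial_def using assms
  by (auto intro!: derivative_eq_intros simp: inner_commute algebra_simps powr_diff fun_eq_iff)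

lemma gderiv_radial_shift:
  fixes x :: "'a::euclidean_space"
  assumes "0 < c + (x - b) \<bullet> (x - b)"
  shows "GDERIV (\<lambda>x. radial c \<kappa> (x - b)) x :> (2 * \<kappa> * radial c (\<kappa> - 1) (x - b)) *\<^sub>R (x - b)"
  using gderiv_translation[of "radial c \<kappa>" "- b" x] gderiv_radial[of c "x - b" \<kappa>] assms by simp

lemma C2_on_radial:
  fixes b :: "'a::euclidean_space"
  assumes "\<And>x. x \<in> S \<Longrightarrow> 0 < c + (x - b) \<bullet> (x - b)"
  shows "C2_on (\<lambda>x. radial c \<kappa> (x - b)) S"
  unfolding C2_on_def
proof (intro exI conjI ballI)
  let ?G = "\<lambda>x. (2 * \<kappa> * radial c (\<kappa> - 1) (x - b)) *\<^sub>R (x - b)"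
  \<comment> \<open>The Hessian: a multiple of the identity plus a rank-one part, the latter written
    as the inner product with x - b followed by scaling of x - b.\<close>
  let ?Q = "\<lambda>x. (2 * \<kappa> * radial c (\<kappa> - 1) (x - b)) *\<^sub>R id_blinfun
    + (4 * \<kappa> * (\<kappa> - 1) * radial c (\<kappa> - 2) (x - b)) *\<^sub>R
      (blinfun_scaleR_left (x - b) o\<^sub>L blinfun_inner_left (x - b))"
  fix x assume x: "x \<in> S"
  show "GDERIV (\<lambda>x. radial c \<kappa> (x - b)) x :> ?G x"
    using gderiv_radial_shift assms x by blast
  have "((\<lambda>x. radial c (\<kappa> - 1) (x - b)) has_derivative
      (\<lambda>h. h \<bullet> ((2 * (\<kappa> - 1) * radial c (\<kappa> - 1 - 1) (x - b)) *\<^sub>R (x - b)))) (at x)"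
    using gderiv_radial_shift[OF assms[OF x]] by (simp only: gderiv_def)
  from has_derivative_scaleR[OF has_derivative_mult_right[OF this, of "2 * \<kappa>"]
      has_derivative_diff[OF has_derivative_ident has_derivative_const[of b]]]
  show "(?G has_derivative blinfun_apply (?Q x)) (at x)"
    by (rule has_derivative_eq_rhs) (simp add: fun_eq_iff blinfun.bilinear_simps algebra_simps)
next
  show "continuous_on S (\<lambda>x. (2 * \<kappa> * radial c (\<kappa> - 1) (x - b)) *\<^sub>R id_blinfun
    + (4 * \<kappa> * (\<kappa> - 1) * radial c (\<kappa> - 2) (x - b)) *\<^sub>R
      (blinfun_scaleR_left (x - b) o\<^sub>L blinfun_inner_left (x - b)))"
    unfolding radial_def using assms
    by (intro continuous_intros bounded_bilinear.continuous_on[OF bounded_bilinear_blinfun_compose]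
        bounded_linear.continuous_on[OF bounded_linear_blinfun_scaleR_left]
        bounded_linear.continuous_on[OF bounded_linear_blinfun_inner_left]) force+
qed

lemma gderiv_lincomb:
  assumes "GDERIV f x :> F" "GDERIV g x :> G"
  shows "GDERIV (\<lambda>x. k + A * f x + B * g x) x :> A *\<^sub>R F + B *\<^sub>R G"
  using has_derivative_add[OF has_derivative_add[OF has_derivative_const[of k]
        has_derivative_mult_right[OF assms(1)[unfolded gderiv_def], of A]]
      has_derivative_mult_right[OF assms(2)[unfolded gderiv_def], of B]]
  unfolding gderiv_def by (simp add: inner_add_right)

lemma C2_on_lincomb:
  assumes "C2_on f S" "C2_on g S"
  shows "C2_on (\<lambda>x. k + A * f x + B * g x) S"
proof -
  from assms(1) obtain Gf Qf where f: "\<And>x. x \<in> S \<Longrightarrow> GDERIV f x :> Gf x"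
      "\<And>x. x \<in> S \<Longrightarrow> (Gf has_derivative blinfun_apply (Qf x)) (at x)" "continuous_on S Qf"
    unfolding C2_on_def by blast
  from assms(2) obtain Gg Qg where g: "\<And>x. x \<in> S \<Longrightarrow> GDERIV g x :> Gg x"
      "\<And>x. x \<in> S \<Longrightarrow> (Gg has_derivative blinfun_apply (Qg x)) (at x)" "continuous_on S Qg"
    unfolding C2_on_def by blast
  show ?thesis
    unfolding C2_on_def
  proof (intro exI conjI ballI)
    fix x assume x: "x \<in> S"
    show "GDERIV (\<lambda>x. k + A * f x + B * g x) x :> A *\<^sub>R Gf x + B *\<^sub>R Gg x"
      by (rule gderiv_lincomb[OF f(1)[OF x] g(1)[OF x]])
    show "((\<lambda>x. A *\<^sub>R Gf x + B *\<^sub>R Gg x) has_derivative blinfun_apply (A *\<^sub>R Qf x + B *\<^sub>R Qg x)) (at x)"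
      using has_derivative_add[OF has_derivative_scaleR_right[OF f(2)[OF x], of A]
          has_derivative_scaleR_right[OF g(2)[OF x], of B]]
      by (rule has_derivative_eq_rhs) (simp add: fun_eq_iff blinfun.bilinear_simps)
  next
    show "continuous_on S (\<lambda>x. A *\<^sub>R Qf x + B *\<^sub>R Qg x)"
      by (intro continuous_intros f(3) g(3))
  qed
qed

text \<open>Differentiability of the gradient at the centre gives |G y - G x| \<le> C |y - x|. The
  mean value inequality for \<open>f\<close> minus its linear part, on the ball of radius |h|, turns
  this into the remainder C |h|^2.\<close>

lemma C2_on_imp_C11_at:
  fixes f :: "'a::euclidean_space \<Rightarrow> real"
  assumes "C2_on f (ball x r)" "0 < r"
  shows "C11_at f x"
proof -
  from assms(1) obtain G Q where G: "\<And>y. y \<in> ball x r \<Longrightarrow> GDERIV f y :> G y"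
      "\<And>y. y \<in> ball x r \<Longrightarrow> (G has_derivative blinfun_apply (Q y)) (at y)"
    unfolding C2_on_def by blast
  have "(G has_derivative blinfun_apply (Q x)) (at x)" using G(2) assms(2) by simp
  then obtain d where d: "0 < d"
    "\<And>y. norm (y - x) < d \<Longrightarrow> norm (G y - G x - Q x (y - x)) \<le> 1 * norm (y - x)"
    unfolding has_derivative_at_alt using zero_less_one by blast
  define C where "C = 1 + norm (Q x)"
  have lip: "norm (G y - G x) \<le> C * norm (y - x)" if "norm (y - x) < d" for y
  proof -
    have "norm (G y - G x) \<le> norm (G y - G x - Q x (y - x)) + norm (Q x (y - x))"
      using norm_triangle_ineq[of "G y - G x - Q x (y - x)" "Q x (y - x)"] by simp
    also have "\<dots> \<le> 1 * norm (y - x) + norm (Q x) * norm (y - x)"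
      by (intro add_mono d(2) that norm_blinfun)
    finally show ?thesis by (simp add: C_def algebra_simps)
  qed
  have "\<bar>f (x + h) - f x - G x \<bullet> h\<bar> \<le> C * (norm h)\<^sup>2" if h: "norm h < min d r" for h
  proof -
    let ?F = "\<lambda>y. f y - G x \<bullet> (y - x)"
    have "norm (?F (x + h) - ?F x) \<le> (C * norm h) * norm (x + h - x)"
    proof (rule differentiable_bound)
      fix y assume "y \<in> cball x (norm h)"
      then have yh: "norm (y - x) \<le> norm h" by (simp add: dist_norm norm_minus_commute)
      then have y: "y \<in> ball x r" "norm (y - x) < d" using h by (auto simp: dist_norm norm_minus_commute)
      show "(?F has_derivative (\<lambda>k. k \<bullet> (G y - G x))) (at y within cball x (norm h))"
      proof (rule has_derivative_at_withinI)
        have "((\<lambda>y. G x \<bullet> (y - x)) has_derivative (\<lambda>k. G x \<bullet> k)) (at y)"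
          by (auto intro!: derivative_eq_intros)
        from has_derivative_diff[OF G(1)[OF y(1), unfolded gderiv_def] this]
        show "(?F has_derivative (\<lambda>k. k \<bullet> (G y - G x))) (at y)"
          by (simp add: inner_diff_right inner_commute)
      qed
      show "onorm (\<lambda>k. k \<bullet> (G y - G x)) \<le> C * norm h"
      proof (rule onorm_le)
        fix k :: 'a
        have "norm (k \<bullet> (G y - G x)) \<le> norm (G y - G x) * norm k"
          using Cauchy_Schwarz_ineq2[of k "G y - G x"] by (simp add: mult.commute)
        also have "norm (G y - G x) \<le> C * norm h"
          using lip[OF y(2)] mult_left_mono[OF yh, of C] by (simp add: C_def)
        finally show "norm (k \<bullet> (G y - G x)) \<le> C * norm h * norm k"
          by (simp add: mult_right_mono)
      qed
    qed (auto simp: dist_norm)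
    then show ?thesis by (simp add: power2_eq_square mult.assoc)
  qed
  then show ?thesis
    unfolding C11_at_def using d(1) assms(2) by (intro exI[of _ "G x"] exI[of _ C] exI[of _ "min d r"]) auto
qed

text \<open>Continuity up to the closed ball excludes blow-up at the boundary, so the part inside is
  integrable by compactness.\<close>

lemma glue_in_L1_weighted:
  fixes u \<phi> :: "'a::euclidean_space \<Rightarrow> real"
  assumes u: "u \<in> L1_weighted s" and \<phi>: "continuous_on (cball x r) \<phi>"
  shows "glue x r \<phi> u \<in> L1_weighted s"
proof -
  have "continuous_on (cball x r) (weight s :: 'a \<Rightarrow> real)"
    unfolding weight_def
    by (intro continuous_intros) (simp add: less_imp_neq[OF one_plus_norm_pos, symmetric])
  then have "integrable lborel (\<lambda>z. indicator (cball x r) z *\<^sub>R (\<phi> z * weight s z))"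
    by (intro borel_integrable_compact continuous_on_mult \<phi>) auto
  then have "integrable lebesgue (\<lambda>z. indicator (cball x r) z *\<^sub>R (\<phi> z * weight s z))"
    by (simp add: integrable_completion borel_measurable_integrable)
  from integrable_mult_indicator[OF _ this, of "ball x r"]
  have "integrable lebesgue (\<lambda>z. indicator (ball x r) z *\<^sub>R (indicator (cball x r) z *\<^sub>R (\<phi> z * weight s z)))"
    by simp
  moreover have "integrable lebesgue (\<lambda>z. indicator (- ball x r) z *\<^sub>R (u z * weight s z))"
    using u by (intro integrable_mult_indicator) (auto simp: L1_weighted_def)
  ultimately have "integrable lebesgue (\<lambda>z.
      indicator (ball x r) z *\<^sub>R (indicator (cball x r) z *\<^sub>R (\<phi> z * weight s z))
      + indicator (- ball x r) z *\<^sub>R (u z * weight s z))"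
    by (rule Bochner_Integration.integrable_add)
  also have "(\<lambda>z. indicator (ball x r) z *\<^sub>R (indicator (cball x r) z *\<^sub>R (\<phi> z * weight s z))
      + indicator (- ball x r) z *\<^sub>R (u z * weight s z)) = (\<lambda>z. glue x r \<phi> u z * weight s z)"
    by (auto simp: fun_eq_iff glue_def indicator_def)
  finally show ?thesis by (simp add: L1_weighted_def)
qed

section \<open>Strict concavity made quantitative\<close>

text \<open>The bases 5/4 and 3/4 are the relative lengths of a + a/4 and a - a/4. Strict concavity
  puts the sum of their powers below 2, and continuity leaves room for \<rho>, which yields a whole
  ball of increments around a/4 and hence a set of positive measure.\<close>

lemma powr_concavity_gap:
  fixes \<theta> :: real
  assumes "0 < \<theta>" "\<theta> < 1"
  obtains \<rho> c where "0 < \<rho>" "\<rho> \<le> 1 / 8" "0 < c"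
    "(5 / 4 + \<rho>) powr \<theta> + (3 / 4 + \<rho>) powr \<theta> \<le> 2 - c"
proof -
  define q where "q = (9 / 8) powr (\<theta> - 1)"
  have "q < 1" using assms by (simp add: q_def powr_less_one)
  have "(5 / 4) powr \<theta> \<le> (9 / 8) powr \<theta> + \<theta> * q * (5 / 4 - 9 / 8)"
    unfolding q_def using assms by (intro powr_le_tangent) auto
  moreover have "(9 / 8) powr \<theta> \<le> 1 powr \<theta> + \<theta> * 1 powr (\<theta> - 1) * (9 / 8 - 1)"
    "(3 / 4) powr \<theta> \<le> 1 powr \<theta> + \<theta> * 1 powr (\<theta> - 1) * (3 / 4 - 1)"
    using assms powr_le_tangent[of 1 "9 / 8" \<theta>] powr_le_tangent[of 1 "3 / 4" \<theta>] by auto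
  \<comment> \<open>The tangent at 9/8 rather than at 1 makes the inequality strict.\<close>
  moreover have "\<theta> * q < \<theta>" using assms \<open>q < 1\<close> by simp
  ultimately have less: "(5 / 4) powr \<theta> + (3 / 4) powr \<theta> < 2"
    by simp
  \<comment> \<open>Half of the gap; the other half pays for the perturbation by \<rho>.\<close>
  define c where "c = (2 - ((5 / 4) powr \<theta> + (3 / 4) powr \<theta>)) / 2"
  have c: "0 < c" "(5 / 4) powr \<theta> + (3 / 4) powr \<theta> < 2 - c" using less by (simp_all add: c_def field_simps)
  have "((\<lambda>t. (5 / 4 + t) powr \<theta> + (3 / 4 + t) powr \<theta>) \<longlongrightarrow>
      (5 / 4 + 0) powr \<theta> + (3 / 4 + 0) powr \<theta>) (at_right 0)"
    by (intro tendsto_intros) auto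
  then have "\<forall>\<^sub>F t in at_right 0. (5 / 4 + t) powr \<theta> + (3 / 4 + t) powr \<theta> < 2 - c"
    using c by (intro order_tendstoD) auto
  moreover have "\<forall>\<^sub>F t in at_right 0. t < (1 / 8 :: real)"
    by (auto simp: eventually_at_right_field intro!: exI[of _ "1/8"])
  moreover have "\<forall>\<^sub>F t in at_right 0. (0 :: real) < t"
    by (auto simp: eventually_at_right_field intro!: exI[of _ "1"])
  ultimately have "\<forall>\<^sub>F t in at_right (0::real).
      (5 / 4 + t) powr \<theta> + (3 / 4 + t) powr \<theta> < 2 - c \<and> t < 1 / 8 \<and> 0 < t"
    by eventually_elim auto
  from eventually_happens[OF this] obtain t where
    "(5 / 4 + t) powr \<theta> + (3 / 4 + t) powr \<theta> < 2 - c" "t < 1 / 8" "0 < t"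
    by auto
  then show ?thesis using c(1) by (intro that[of t c]) auto
qed

text \<open>The lower bound keeps these increments off the small balls carrying the test functions,
  the upper bound |z| \<le> |a| bounds the kernel from below, and the last two feed the concavity
  gap.\<close>

lemma quarter_ball_norm_bounds:
  fixes a z :: "'a::euclidean_space"
  assumes "z \<in> ball ((1 / 4) *\<^sub>R a) (\<rho> * norm a)" "\<rho> \<le> 1 / 8"
  shows "norm a / 8 < norm z" "norm z \<le> norm a"
    "norm (a + z) \<le> (5 / 4 + \<rho>) * norm a" "norm (a - z) \<le> (3 / 4 + \<rho>) * norm a"
proof -
  define w where "w = z - (1 / 4) *\<^sub>R a"
  have w: "norm w < \<rho> * norm a" using assms(1) by (simp add: w_def dist_norm norm_minus_commute)
  have z: "z = (1 / 4) *\<^sub>R a + w" by (simp add: w_def)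
  have \<rho>: "\<rho> * norm a \<le> norm a / 8" using mult_right_mono[OF assms(2), of "norm a"] by simp
  have "norm a / 4 - norm w \<le> norm z" "norm z \<le> norm a / 4 + norm w"
    using norm_triangle_ineq[of "(1 / 4) *\<^sub>R a" w] norm_diff_ineq[of "(1 / 4) *\<^sub>R a" w]
    by (auto simp: z)
  then show "norm a / 8 < norm z" "norm z \<le> norm a" using w \<rho> norm_ge_zero[of a] by linarith+
  have "a + z = (5 / 4) *\<^sub>R a + w" "a - z = (3 / 4) *\<^sub>R a - w"
    using scaleR_left_distrib[of 1 "1 / 4" a] scaleR_left_diff_distrib[of 1 "1 / 4" a]
    by (auto simp: z)
  then have "norm (a + z) \<le> 5 / 4 * norm a + norm w" "norm (a - z) \<le> 3 / 4 * norm a + norm w"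
    using norm_triangle_ineq[of "(5 / 4) *\<^sub>R a" w] norm_triangle_ineq4[of "(3 / 4) *\<^sub>R a" w]
    by auto
  then show "norm (a + z) \<le> (5 / 4 + \<rho>) * norm a" "norm (a - z) \<le> (3 / 4 + \<rho>) * norm a"
    using w by (auto simp: algebra_simps)
qed

lemma norm_powr_second_difference_gap:
  fixes a z :: "'a::euclidean_space"
  assumes gap: "(5 / 4 + \<rho>) powr \<theta> + (3 / 4 + \<rho>) powr \<theta> \<le> 2 - c"
    and z: "z \<in> ball ((1 / 4) *\<^sub>R a) (\<rho> * norm a)" and "\<rho> \<le> 1 / 8" "0 < \<rho>" "0 < \<theta>"
  shows "norm (a + z) powr \<theta> + norm (a - z) powr \<theta> - 2 * norm a powr \<theta> \<le> - c * norm a powr \<theta>"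
proof -
  have "norm (a + z) powr \<theta> \<le> ((5 / 4 + \<rho>) * norm a) powr \<theta>"
    "norm (a - z) powr \<theta> \<le> ((3 / 4 + \<rho>) * norm a) powr \<theta>"
    using assms quarter_ball_norm_bounds[OF z] by (auto intro!: powr_mono2)
  then have "norm (a + z) powr \<theta> + norm (a - z) powr \<theta>
      \<le> ((5 / 4 + \<rho>) powr \<theta> + (3 / 4 + \<rho>) powr \<theta>) * norm a powr \<theta>"
    unfolding powr_mult by (simp add: distrib_right)
  also have "\<dots> \<le> (2 - c) * norm a powr \<theta>"
    by (intro mult_right_mono gap) auto
  finally show ?thesis by (simp add: algebra_simps)
qed

section \<open>Second differences of the penalty\<close>

text \<open>A majorant with separate exponents near 0 and near infinity. For \<sigma> < 2s < e it is
  integrable against the kernel bound at both ends; it is used with e = s + 1.\<close>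

definition two_scale :: "real \<Rightarrow> real \<Rightarrow> 'a::euclidean_space \<Rightarrow> real" where
  "two_scale e \<sigma> z = (if norm z < 1 then norm z powr e else norm z powr \<sigma>)"

lemma two_scale_nonneg: "0 \<le> two_scale e \<sigma> z"
  by (simp add: two_scale_def)

lemma two_scale_integrable:
  assumes "\<sigma> < 2 * s" "2 * s < e"
  shows "integrable lebesgue
    (\<lambda>z::'a::euclidean_space. two_scale e \<sigma> z * norm z powr (- real DIM('a) - 2 * s))"
proof -
  have "integrable lebesgue (\<lambda>z::'a. indicator (ball 0 1) z * norm z powr ((e - 2 * s) - real DIM('a))
      + indicator (- ball 0 1) z * norm z powr ((\<sigma> - 2 * s) - real DIM('a)))"
    using assms by (intro Bochner_Integration.integrable_add powr_norm_integrable_unit_ball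
        powr_norm_integrable_outside_unit_ball) auto
  also have "(\<lambda>z::'a. indicator (ball 0 1) z * norm z powr ((e - 2 * s) - real DIM('a))
      + indicator (- ball 0 1) z * norm z powr ((\<sigma> - 2 * s) - real DIM('a)))
    = (\<lambda>z. two_scale e \<sigma> z * norm z powr (- real DIM('a) - 2 * s))"
    by (auto simp: fun_eq_iff two_scale_def indicator_def simp flip: powr_add intro!: arg_cong[of _ _ "(powr) _"])
  finally show ?thesis .
qed

definition japanese_bracket :: "'a::euclidean_space \<Rightarrow> real" where
  "japanese_bracket x = radial 1 (1 / 2) x"

lemma japanese_bracket_sq: "1 + x \<bullet> x = (japanese_bracket x)\<^sup>2"
  by (simp add: japanese_bracket_def radial_def powr_half_sqrt)

lemma japanese_bracket_ge_1: "1 \<le> japanese_bracket x"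
  by (simp add: japanese_bracket_def radial_def ge_one_powr_ge_zero)

lemma norm_le_japanese_bracket: "norm x \<le> japanese_bracket x"
proof (rule power2_le_imp_le)
  show "(norm x)\<^sup>2 \<le> (japanese_bracket x)\<^sup>2" by (simp add: japanese_bracket_sq[symmetric] power2_norm_eq_inner)
  show "0 \<le> japanese_bracket x" using japanese_bracket_ge_1[of x] by simp
qed

lemma radial_1_eq: "radial 1 \<kappa> x = japanese_bracket x powr (2 * \<kappa>)"
  by (simp add: japanese_bracket_def radial_def powr_powr)

text \<open>After squaring, only x \<bullet> z \<le> J |z| has to be checked, where J is the bracket
  of \<open>x\<close>.\<close>

lemma japanese_bracket_add_le: "japanese_bracket (x + z) \<le> japanese_bracket x + norm z"
proof (rule power2_le_imp_le)
  have "x \<bullet> z \<le> japanese_bracket x * norm z"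
    using norm_cauchy_schwarz[of x z] mult_right_mono[OF norm_le_japanese_bracket[of x] norm_ge_zero[of z]]
    by linarith
  then show "(japanese_bracket (x + z))\<^sup>2 \<le> (japanese_bracket x + norm z)\<^sup>2"
    unfolding power2_sum japanese_bracket_sq[symmetric]
    by (simp add: power2_norm_eq_inner inner_add_left inner_add_right inner_commute)
  show "0 \<le> japanese_bracket x + norm z" using japanese_bracket_ge_1[of x] by simp
qed

text \<open>Decay J^(\<gamma> - \<sigma>) in \<open>x\<close> is bought with growth |z|^\<sigma>.
  For |z| \<le> J concavity gives J^(\<gamma>-2) |z|^2: if |z| < 1, then |z|^2 \<le> |z|^e and
  \<sigma> \<le> 2 suffice, and otherwise |z|^(2-\<sigma>) \<le> J^(2-\<sigma>). For |z| > J
  subadditivity gives |z|^\<gamma>, and |z|^(\<gamma>-\<sigma>) \<le> J^(\<gamma>-\<sigma>) because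
  \<gamma> < \<sigma>.\<close>

lemma radial_1_second_difference_le:
  fixes x z :: "'a::euclidean_space"
  assumes "0 < \<gamma>" "\<gamma> < 1" "\<gamma> < \<sigma>" "\<sigma> \<le> e" "e \<le> 2"
  shows "radial 1 (\<gamma> / 2) (x + z) + radial 1 (\<gamma> / 2) (x - z) - 2 * radial 1 (\<gamma> / 2) x
    \<le> 2 * japanese_bracket x powr (\<gamma> - \<sigma>) * two_scale e \<sigma> z"
proof -
  let ?J = "japanese_bracket x"
  let ?S = "radial 1 (\<gamma> / 2) (x + z) + radial 1 (\<gamma> / 2) (x - z) - 2 * radial 1 (\<gamma> / 2) x"
  have J: "1 \<le> ?J" by (rule japanese_bracket_ge_1)
  show ?thesis
  proof (cases "norm z \<le> ?J")
    case True
    have "?S \<le> 2 * (\<gamma> / 2) * radial 1 (\<gamma> / 2 - 1) x * (z \<bullet> z)"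
      using assms by (intro radial_second_difference_le) (auto simp: add_pos_nonneg)
    also have "\<dots> = \<gamma> * (?J powr (\<gamma> - 2) * (norm z powr 2))"
      by (simp add: radial_1_eq algebra_simps power2_norm_eq_inner)
    also have "\<dots> \<le> 2 * (?J powr (\<gamma> - 2) * (norm z powr 2))"
      using assms by (intro mult_right_mono) auto
    also have "?J powr (\<gamma> - 2) * (norm z powr 2) \<le> ?J powr (\<gamma> - \<sigma>) * two_scale e \<sigma> z"
    proof (cases "norm z < 1")
      case z: True
      have "norm z powr 2 \<le> norm z powr e"
        using powr_mono'[of e 2 "norm z"] z assms by (cases "z = 0") auto
      from mult_mono[OF powr_mono[of "\<gamma> - 2" "\<gamma> - \<sigma>" ?J] this] show ?thesis
        using z J assms by (simp add: two_scale_def)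
    next
      case z: False
      have "norm z powr 2 = norm z powr \<sigma> * norm z powr (2 - \<sigma>)" by (simp flip: powr_add)
      also have "\<dots> \<le> norm z powr \<sigma> * ?J powr (2 - \<sigma>)"
        using True assms by (intro mult_left_mono powr_mono2) auto
      finally have "?J powr (\<gamma> - 2) * norm z powr 2
          \<le> ?J powr (\<gamma> - 2) * (norm z powr \<sigma> * ?J powr (2 - \<sigma>))"
        by (intro mult_left_mono) auto
      also have "\<dots> = ?J powr ((\<gamma> - 2) + (2 - \<sigma>)) * norm z powr \<sigma>"
        by (simp only: powr_add mult_ac)
      finally show ?thesis using z by (simp add: two_scale_def)
    qed
    finally show ?thesis by simp
  next
    case False
    have *: "radial 1 (\<gamma> / 2) (x + w) \<le> radial 1 (\<gamma> / 2) x + norm w powr \<gamma>" for w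
    proof -
      have "japanese_bracket (x + w) powr \<gamma> \<le> (?J + norm w) powr \<gamma>"
        using assms japanese_bracket_ge_1[of "x + w"] by (intro powr_mono2 japanese_bracket_add_le) auto
      also have "\<dots> \<le> ?J powr \<gamma> + norm w powr \<gamma>"
        using J assms by (intro powr_add_le_add_powr) auto
      finally show ?thesis by (simp add: radial_1_eq)
    qed
    have "?S \<le> 2 * norm z powr \<gamma>" using *[of z] *[of "- z"] by simp
    also have "norm z powr \<gamma> = norm z powr (\<gamma> - \<sigma>) * norm z powr \<sigma>" by (simp flip: powr_add)
    also have "\<dots> \<le> ?J powr (\<gamma> - \<sigma>) * norm z powr \<sigma>"
      using False J assms by (intro mult_right_mono powr_mono2') auto
    finally show ?thesis using False J by (simp add: two_scale_def)
  qed
qed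

section \<open>The inequality at a maximum of the doubled function\<close>

text \<open>For an even kernel, reflection replaces \<open>g\<close> by its symmetrisation, whence
  the factor 2. The positive part of the bound is paired with the upper kernel bound, the gain on
  \<open>S\<close> with the lower one, which is smallest at |z| = R.\<close>

lemma symmetric_kernel_integral_le:
  fixes g K :: "'a::euclidean_space \<Rightarrow> real"
  assumes K: "K \<in> K_sym s lam Lam" and int: "integrable lebesgue (\<lambda>z. g z * K z)"
    and par: "0 < s" "0 \<le> lam" "0 \<le> A" "0 \<le> B" "\<sigma> < 2 * s" "2 * s < e"
    and S: "S \<in> sets lebesgue" "emeasure lebesgue S < \<infinity>" "0 \<notin> S" "\<And>z. z \<in> S \<Longrightarrow> norm z \<le> R"
    and g0: "g 0 = 0"
    and bound: "\<And>z. g z + g (- z) \<le> A * two_scale e \<sigma> z - B * indicator S z"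
  shows "2 * (LINT z|lebesgue. g z * K z)
    \<le> A * Lam * (LINT z|lebesgue. two_scale e \<sigma> (z::'a) * norm z powr (- real DIM('a) - 2 * s))
      - B * lam * R powr (- real DIM('a) - 2 * s) * measure lebesgue S"
proof -
  let ?e = "- real DIM('a) - 2 * s"
  let ?W = "\<lambda>z::'a. two_scale e \<sigma> z * norm z powr ?e"
  have even: "g (- z) * K (- z) = g (- z) * K z" for z
    using K_sym_bounds(4)[OF K, of z] by (cases "z = 0") auto
  have int': "integrable lebesgue (\<lambda>z. g (- z) * K z)"
    using integrable_lebesgue_uminus[OF int] by (simp only: even)
  have "2 * (LINT z|lebesgue. g z * K z) = (LINT z|lebesgue. g z * K z) + (LINT z|lebesgue. g (- z) * K (- z))"
    using integral_lebesgue_uminus[of "\<lambda>z. g z * K z"] int by simp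
  also have "\<dots> = (LINT z|lebesgue. (g z + g (- z)) * K z)"
    unfolding even distrib_right by (rule Bochner_Integration.integral_add[OF int int', symmetric])
  also have "\<dots> \<le> (LINT z|lebesgue. A * Lam * ?W z - B * lam * R powr ?e * indicator S z)"
  proof (rule Bochner_Integration.integral_mono)
    show "integrable lebesgue (\<lambda>z. (g z + g (- z)) * K z)"
      unfolding distrib_right by (rule Bochner_Integration.integrable_add[OF int int'])
    show "integrable lebesgue (\<lambda>z. A * Lam * ?W z - B * lam * R powr ?e * indicator S z)"
      by (intro Bochner_Integration.integrable_diff integrable_mult_right two_scale_integrable
          integrable_real_indicator par S)
    fix z :: 'a
    show "(g z + g (- z)) * K z \<le> A * Lam * ?W z - B * lam * R powr ?e * indicator S z"
    proof (cases "z = 0")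
      case True
      \<comment> \<open>At the origin \<open>K\<close> is arbitrary, but \<open>g 0 = 0\<close>
        removes it, and the right-hand side is 0 there.\<close>
      then show ?thesis using g0 S(3) by simp
    next
      case z: False
      note Kz = K_sym_bounds(1-3)[OF K z]
      have ind: "indicator S z * (lam * R powr ?e) \<le> indicator S z * K z"
      proof (cases "z \<in> S")
        case True
        have "lam * R powr ?e \<le> lam * norm z powr ?e"
          using z S(4)[OF True] par by (intro mult_left_mono powr_mono2') auto
        then show ?thesis using Kz(2) True by simp
      qed simp
      have "(g z + g (- z)) * K z \<le> (A * two_scale e \<sigma> z - B * indicator S z) * K z"
        using bound Kz(1) by (rule mult_right_mono)
      also have "\<dots> = A * two_scale e \<sigma> z * K z - B * (indicator S z * K z)"
        by (simp add: algebra_simps)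
      also have "\<dots> \<le> A * two_scale e \<sigma> z * (Lam * norm z powr ?e)
          - B * (indicator S z * (lam * R powr ?e))"
        using diff_mono[OF mult_left_mono[OF Kz(3), of "A * two_scale e \<sigma> z"]
            mult_left_mono[OF ind \<open>0 \<le> B\<close>]] par(3) two_scale_nonneg[of e \<sigma> z] by simp
      finally show ?thesis by (simp add: mult_ac)
    qed
  qed
  also have "\<dots> = A * Lam * (LINT z|lebesgue. ?W z) - B * lam * R powr ?e * measure lebesgue S"
  proof (subst Bochner_Integration.integral_diff)
    show "integrable lebesgue (\<lambda>z. A * Lam * ?W z)"
      "integrable lebesgue (\<lambda>z. B * lam * R powr ?e * indicator S z)"
      by (intro integrable_mult_right two_scale_integrable integrable_real_indicator par S)+
    show "(LINT z|lebesgue. A * Lam * ?W z) - (LINT z|lebesgue. B * lam * R powr ?e * indicator S z)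
        = A * Lam * (LINT z|lebesgue. ?W z) - B * lam * R powr ?e * measure lebesgue S"
      by simp
  qed
  finally show ?thesis .
qed

text \<open>Near \<open>x\<close> the glued function is \<phi> and inherits its expansion and
  gradient. Recentring at 0 prepares the comparison of two functions tested at different
  points.\<close>

lemma glued_test_function:
  fixes u \<phi> :: "'a::euclidean_space \<Rightarrow> real"
  assumes C2: "C2_on \<phi> (ball x r)" and cont: "continuous_on (cball x r) \<phi>" and "0 < r" "0 \<le> s"
    and u: "u \<in> L1_weighted s" and D: "GDERIV \<phi> x :> D"
  shows "glue x r \<phi> u \<in> L1_weighted s" "admissible s (glue x r \<phi> u) x"
    "admissible s (\<lambda>z. glue x r \<phi> u (x + z)) 0" "grad (\<lambda>z. glue x r \<phi> u (x + z)) 0 = D"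
proof -
  show L1: "glue x r \<phi> u \<in> L1_weighted s"
    using u cont by (rule glue_in_L1_weighted)
  have eq: "glue x r \<phi> u y = \<phi> y" if "y \<in> ball x r" for y
    using that by (simp add: glue_def)
  obtain p C \<delta> where \<delta>: "0 < \<delta>"
    "\<And>h. norm h < \<delta> \<Longrightarrow> \<bar>\<phi> (x + h) - \<phi> x - p \<bullet> h\<bar> \<le> C * (norm h)\<^sup>2"
    using C2_on_imp_C11_at[OF C2 \<open>0 < r\<close>] unfolding C11_at_def by blast
  have "\<bar>glue x r \<phi> u (x + h) - glue x r \<phi> u x - p \<bullet> h\<bar> \<le> C * (norm h)\<^sup>2" if "norm h < min \<delta> r" for h
    using that \<delta>(2)[of h] eq[of "x + h"] eq[of x] \<open>0 < r\<close> by (simp add: dist_norm)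
  then have "C11_at (glue x r \<phi> u) x"
    unfolding C11_at_def using \<delta>(1) \<open>0 < r\<close>
    by (intro exI[of _ p] exI[of _ C] exI[of _ "min \<delta> r"]) auto
  with L1 show adm: "admissible s (glue x r \<phi> u) x" by (simp add: admissible_def)
  show "admissible s (\<lambda>z. glue x r \<phi> u (x + z)) 0"
    using adm \<open>0 \<le> s\<close> by (rule admissible_translation)
  have "(glue x r \<phi> u has_derivative (\<lambda>h. h \<bullet> D)) (at x)"
    using D unfolding gderiv_def
    by (rule has_derivative_transform_within_open[of _ _ _ _ "ball x r"]) (use eq \<open>0 < r\<close> in auto)
  then have "GDERIV (glue x r \<phi> u) (x + 0) :> D" by (simp add: gderiv_def)
  then show "grad (\<lambda>z. glue x r \<phi> u (x + z)) 0 = D"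
    by (intro grad_eq gderiv_translation)
qed

text \<open>Transfers a bound uniform over all kernels to the nonlinear operator, so that only
  linear integrals remain to be estimated.\<close>

lemma elliptic_sym_at_0_le:
  fixes f1 f2 :: "'a::euclidean_space \<Rightarrow> real"
  assumes ell: "elliptic_sym s lam Lam I" and par: "1 / 2 < s" "s < 1" "0 < lam" "lam \<le> Lam"
    and adm: "admissible s f1 0" "admissible s f2 0"
    and le: "\<And>K. K \<in> K_sym s lam Lam \<Longrightarrow>
      integrable lebesgue (\<lambda>z. (L_integrand f1 z - L_integrand f2 z) * K z) \<Longrightarrow>
      (LINT z|lebesgue. (L_integrand f1 z - L_integrand f2 z) * K z) \<le> T"
  shows "I f1 0 - I f2 0 \<le> T"
proof -
  have "I f1 0 - I f2 0 \<le> (SUP K\<in>K_sym s lam Lam. nonlocal_L s K f1 0 - nonlocal_L s K f2 0)"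
    using ell adm unfolding elliptic_sym_def by blast
  also have "\<dots> \<le> T"
  proof (rule cSUP_least)
    \<comment> \<open>A common upper bound passes to a real supremum only over a nonempty
      family.\<close>
    show "K_sym s lam Lam \<noteq> ({} :: ('a \<Rightarrow> real) set)"
      using K_sym_nonempty[of lam Lam] par by (metis empty_iff less_imp_le)
    fix K :: "'a \<Rightarrow> real" assume K: "K \<in> K_sym s lam Lam"
    have int: "integrable lebesgue (\<lambda>z. L_integrand f1 z * K z)"
      "integrable lebesgue (\<lambda>z. L_integrand f2 z * K z)"
      using par by (auto intro!: L_integrand_integrable[OF _ K] adm)
    have "nonlocal_L s K f1 0 - nonlocal_L s K f2 0
        = (LINT z|lebesgue. (L_integrand f1 z - L_integrand f2 z) * K z)"
      unfolding nonlocal_L_at_0[OF par(1,2)] left_diff_distrib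
      by (rule Bochner_Integration.integral_diff[OF int, symmetric])
    also have "\<dots> \<le> T"
      using K Bochner_Integration.integrable_diff[OF int] by (intro le) (simp_all add: left_diff_distrib)
    finally show "nonlocal_L s K f1 0 - nonlocal_L s K f2 0 \<le> T" .
  qed
  finally show ?thesis .
qed

lemma viscosity_subsolution_test:
  assumes "viscosity_subsolution s I (\<lambda>x t p. H p) UNIV u" "0 < r" "C2_on \<phi> (ball x r)"
    "u x = \<phi> x" "\<And>y. u y \<le> \<phi> y" "glue x r \<phi> u \<in> L1_weighted s"
  shows "- I (glue x r \<phi> u) x + H (grad \<phi> x) \<le> 0"
  using assms unfolding viscosity_subsolution_def by blast

lemma viscosity_supersolution_test:
  assumes "viscosity_supersolution s I (\<lambda>x t p. H p) UNIV u" "0 < r" "C2_on \<phi> (ball x r)"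
    "u x = \<phi> x" "\<And>y. \<phi> y \<le> u y" "glue x r \<phi> u \<in> L1_weighted s"
  shows "0 \<le> - I (glue x r \<phi> u) x + H (grad \<phi> x)"
  using assms unfolding viscosity_supersolution_def by blast

lemma continuous_on_norm_powr:
  assumes "0 < e" "continuous_on A f"
  shows "continuous_on A (\<lambda>x. norm (f x) powr e)"
  using assms by (intro continuous_on_powr' continuous_intros) auto

lemma continuous_on_radial_1:
  assumes "continuous_on A f"
  shows "continuous_on A (\<lambda>x. radial 1 \<kappa> (f x))"
proof -
  have "1 + f x \<bullet> f x \<noteq> 0" for x
    using inner_ge_zero[of "f x"] by linarith
  then show ?thesis unfolding radial_def using assms by (intro continuous_intros) auto
qed

text \<open>The test functions are only used on small balls: their second difference at scale \<open>r\<close>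
  contributes \<open>O(r^(1 - s))\<close>, which vanishes as \<open>r \<rightarrow> 0\<close>.\<close>

lemma doubling_inequality:
  fixes u :: "'a::euclidean_space \<Rightarrow> real" and H :: "'a \<Rightarrow> real"
  assumes s: "1 / 2 < s" "s < 1" and lam: "0 < lam" "lam \<le> Lam"
    and trans: "translation_invariant s I" and ell: "elliptic_sym s lam Lam I"
    and sub: "viscosity_subsolution s I (\<lambda>x t p. H p) UNIV u"
    and super: "viscosity_supersolution s I (\<lambda>x t p. H p) UNIV u"
    and par: "0 < \<theta>" "\<theta> < 1" "0 < \<gamma>" "\<gamma> < 1" "\<gamma> < \<sigma>" "\<sigma> < 2 * s" "\<sigma> \<le> s + 1" "0 < L" "0 \<le> \<epsilon>"
    and gap: "0 < \<rho>" "\<rho> \<le> 1 / 8" "0 < c" "(5 / 4 + \<rho>) powr \<theta> + (3 / 4 + \<rho>) powr \<theta> \<le> 2 - c"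
    and a: "a = x0 - y0" "a \<noteq> 0"
    and max: "\<And>x y. u x - u y - L * norm (x - y) powr \<theta> - \<epsilon> * radial 1 (\<gamma> / 2) x
      \<le> u x0 - u y0 - L * norm a powr \<theta> - \<epsilon> * radial 1 (\<gamma> / 2) x0"
    and p: "p = (L * \<theta> * norm a powr (\<theta> - 2)) *\<^sub>R a"
    and q: "q = (\<epsilon> * \<gamma> * japanese_bracket x0 powr (\<gamma> - 2)) *\<^sub>R x0"
  shows "c * L * norm a powr \<theta> * lam * norm a powr (- real DIM('a) - 2 * s)
      * measure lebesgue (ball ((1 / 4) *\<^sub>R a) (\<rho> * norm a))
    \<le> \<epsilon> * 2 * japanese_bracket x0 powr (\<gamma> - \<sigma>) * Lam
      * (LINT z|lebesgue. two_scale (s + 1) \<sigma> (z::'a) * norm z powr (- real DIM('a) - 2 * s))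
      + 2 * (H p - H (p + q))"
proof -
  let ?N = "LINT z|lebesgue. two_scale (s + 1) \<sigma> (z::'a) * norm z powr (- real DIM('a) - 2 * s)"
  let ?\<psi> = "radial 1 (\<gamma> / 2) :: 'a \<Rightarrow> real"
  define S where "S = ball ((1 / 4) *\<^sub>R a) (\<rho> * norm a)"
  let ?B = "c * L * norm a powr \<theta>"
  let ?M = "?B * lam * norm a powr (- real DIM('a) - 2 * s) * measure lebesgue S"
  define D where "D = 2 * L * \<theta> * norm a powr (\<theta> - 2)"
  define E where "E = \<epsilon> * 2 * japanese_bracket x0 powr (\<gamma> - \<sigma>)"
  have na: "0 < norm a" using a by simp
  \<comment> \<open>The restriction r \<le> |a|/8 keeps the kinks of the powers out of the test
    balls and \<open>S\<close> out of the ball of radius \<open>r\<close> around 0.\<close>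
  have key: "?M \<le> (E + D * r powr (1 - s)) * Lam * ?N + 2 * (H p - H (p + q))"
    if r: "0 < r" "r \<le> 1" "r \<le> norm a / 8" for r
  proof -
    \<comment> \<open>\<phi>1 is the maximality inequality solved for \<open>u x\<close> with y = y0
      frozen, \<phi>2 the one solved for \<open>u y\<close> with x = x0 frozen. The term with
      coefficient 0 fits \<phi>2 to the shape of \<open>C2_on_lincomb\<close>.\<close>
    define \<phi>1 where "\<phi>1 = (\<lambda>y. (u x0 - L * norm a powr \<theta> - \<epsilon> * ?\<psi> x0)
      + L * radial 0 (\<theta> / 2) (y - y0) + \<epsilon> * radial 1 (\<gamma> / 2) (y - 0))"
    define \<phi>2 where "\<phi>2 = (\<lambda>y. (u y0 + L * norm a powr \<theta>)
      + (- L) * radial 0 (\<theta> / 2) (y - x0) + 0 * radial 0 (\<theta> / 2) (y - x0))"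
    have away: "0 < 0 + (y - b) \<bullet> (y - b)" if "y \<in> ball b' r" "norm (b' - b) = norm a" for y b b'
    proof -
      have "y \<noteq> b" using that r na by (auto simp: dist_norm)
      then show ?thesis by simp
    qed
    have C2': "C2_on (\<lambda>y. radial 0 (\<theta> / 2) (y - y0)) (ball x0 r)"
        "C2_on (\<lambda>y. radial 0 (\<theta> / 2) (y - x0)) (ball y0 r)"
        "C2_on (\<lambda>y. radial 1 (\<gamma> / 2) (y - 0)) (ball x0 r)"
      by (rule C2_on_radial; use away[of _ x0 y0] away[of _ y0 x0] a in
          \<open>simp add: norm_minus_commute add_pos_nonneg\<close>)+
    have C2: "C2_on \<phi>1 (ball x0 r)" "C2_on \<phi>2 (ball y0 r)"
      unfolding \<phi>1_def \<phi>2_def by (rule C2_on_lincomb[OF C2'(1,3)], rule C2_on_lincomb[OF C2'(2,2)])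
    have cont: "continuous_on A \<phi>1" "continuous_on A \<phi>2" for A
      unfolding \<phi>1_def \<phi>2_def radial_0
      by (intro continuous_intros continuous_on_norm_powr continuous_on_radial_1 par)+
    have rad: "2 * (\<theta> / 2) * radial 0 (\<theta> / 2 - 1) b = \<theta> * norm b powr (\<theta> - 2)" for b :: 'a
      using radial_0[of "\<theta> - 2" b] by (simp add: diff_divide_distrib)
    have "GDERIV (\<lambda>y. radial 0 (\<theta> / 2) (y - y0)) x0 :> (\<theta> * norm a powr (\<theta> - 2)) *\<^sub>R a"
      using gderiv_radial_shift[of 0 x0 y0 "\<theta> / 2"] a unfolding rad by simp
    moreover have "GDERIV (\<lambda>y. radial 1 (\<gamma> / 2) (y - 0)) x0 :> (\<gamma> * japanese_bracket x0 powr (\<gamma> - 2)) *\<^sub>R x0"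
      using gderiv_radial_shift[of 1 x0 0 "\<gamma> / 2"]
      by (simp add: radial_1_eq add_pos_nonneg right_diff_distrib)
    ultimately have G1: "GDERIV \<phi>1 x0 :> p + q"
      unfolding \<phi>1_def by (rule GDERIV_subst[OF gderiv_lincomb]) (simp add: p q mult.assoc)
    \<comment> \<open>The power enters \<phi>2 with a minus sign and is differentiated at y0 - x0 =
      - a; the two signs cancel, so the gradient is again \<open>p\<close>.\<close>
    have ya: "y0 - x0 = - a" using a by simp
    have g2: "GDERIV (\<lambda>y. radial 0 (\<theta> / 2) (y - x0)) y0 :> (\<theta> * norm a powr (\<theta> - 2)) *\<^sub>R (- a)"
      using gderiv_radial_shift[of 0 y0 x0 "\<theta> / 2"] a(2) unfolding rad ya by simp
    have G2: "GDERIV \<phi>2 y0 :> p"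
      unfolding \<phi>2_def by (rule GDERIV_subst[OF gderiv_lincomb[OF g2 g2]]) (simp add: p mult.assoc)
    have uL1: "u \<in> L1_weighted s" using sub by (simp add: viscosity_subsolution_def)
    define g1 where "g1 = glue x0 r \<phi>1 u"
    define g2 where "g2 = glue y0 r \<phi>2 u"
    define f1 where "f1 = (\<lambda>z. g1 (x0 + z))"
    define f2 where "f2 = (\<lambda>z. g2 (y0 + z))"
    have s0: "0 \<le> s" using s by simp
    note t1 = glued_test_function[OF C2(1) cont(1) r(1) s0 uL1 G1, folded g1_def, folded f1_def]
    note t2 = glued_test_function[OF C2(2) cont(2) r(1) s0 uL1 G2, folded g2_def, folded f2_def]
    have touch1: "u y \<le> \<phi>1 y" for y
      using max[of y y0] by (simp add: \<phi>1_def radial_0)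
    have touch2: "\<phi>2 y \<le> u y" for y
      using max[of x0 y] by (simp add: \<phi>2_def radial_0 norm_minus_commute)
    have at1: "u x0 = \<phi>1 x0" and at2: "u y0 = \<phi>2 y0"
      using a by (auto simp: \<phi>1_def \<phi>2_def radial_0 norm_minus_commute)
    have visc1: "- I g1 x0 + H (p + q) \<le> 0"
      using viscosity_subsolution_test[OF sub r(1) C2(1) at1 touch1] t1(1) grad_eq[OF G1]
      by (simp add: g1_def)
    have visc2: "0 \<le> - I g2 y0 + H p"
      using viscosity_supersolution_test[OF super r(1) C2(2) at2 touch2] t2(1) grad_eq[OF G2]
      by (simp add: g2_def)
    \<comment> \<open>Translation invariance brings both evaluations to the origin, where
      ellipticity can compare them.\<close>
    have "I (\<lambda>y. g1 (y + x0)) 0 = I g1 (0 + x0)" "I (\<lambda>y. g2 (y + y0)) 0 = I g2 (0 + y0)"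
      using trans[unfolded translation_invariant_def, rule_format, of g1 0 x0] t1(2)
        trans[unfolded translation_invariant_def, rule_format, of g2 0 y0] t2(2) by simp_all
    then have I1: "I f1 0 = I g1 x0" and I2: "I f2 0 = I g2 y0"
      by (simp_all add: f1_def f2_def add.commute)
    let ?g = "\<lambda>z. L_integrand f1 z - L_integrand f2 z"
    \<comment> \<open>Three regimes: |z| < r, where the explicit test functions enter; z in
      \<open>S\<close>, where strict concavity gives the gain; all other \<open>z\<close>, where
      only the penalty changes. The gradient terms are odd in \<open>z\<close> and cancel in the
      symmetrisation.\<close>
    have bound: "?g z + ?g (- z) \<le> (E + D * r powr (1 - s)) * two_scale (s + 1) \<sigma> z - ?B * indicator S z" for z
    proof -
      have f0: "f1 0 = u x0" "f2 0 = u y0"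
        using at1 at2 r by (auto simp: f1_def f2_def g1_def g2_def glue_def)
      have psi: "\<epsilon> * (?\<psi> (x0 + z) + ?\<psi> (x0 - z) - 2 * ?\<psi> x0) \<le> E * two_scale (s + 1) \<sigma> z"
        using mult_left_mono[OF radial_1_second_difference_le[of \<gamma> \<sigma> "s + 1" x0 z] par(9)] par s
        by (simp add: E_def mult.assoc)
      have sum: "?g z + ?g (- z) = (f1 z - f2 z) + (f1 (- z) - f2 (- z)) - 2 * (u x0 - u y0)"
        by (simp add: L_integrand_def f0 indicator_def algebra_simps)
      show ?thesis
      proof (cases "norm z < r")
        case True
        have notS: "z \<notin> S"
          using quarter_ball_norm_bounds(1)[of z a \<rho>] True r gap unfolding S_def by force
        have f: "f1 z = \<phi>1 (x0 + z)" "f1 (- z) = \<phi>1 (x0 - z)" "f2 z = \<phi>2 (y0 + z)" "f2 (- z) = \<phi>2 (y0 - z)"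
          using True by (auto simp: f1_def f2_def g1_def g2_def glue_def dist_norm)
        have n: "x0 + z - y0 = a + z" "x0 - z - y0 = a - z" "y0 + z - x0 = - (a - z)" "y0 - z - x0 = - (a + z)"
          using a by auto
        have "?g z + ?g (- z) = 2 * L * (radial 0 (\<theta> / 2) (a + z) + radial 0 (\<theta> / 2) (a - z) - 2 * radial 0 (\<theta> / 2) a)
            + \<epsilon> * (?\<psi> (x0 + z) + ?\<psi> (x0 - z) - 2 * ?\<psi> x0)"
          unfolding sum f \<phi>1_def \<phi>2_def n radial_minus by (simp add: radial_0 algebra_simps)
        also have "\<dots> \<le> 2 * L * (2 * (\<theta> / 2) * radial 0 (\<theta> / 2 - 1) a * (z \<bullet> z)) + E * two_scale (s + 1) \<sigma> z"
          using par a by (intro add_mono mult_left_mono radial_second_difference_le psi) auto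
        also have "2 * L * (2 * (\<theta> / 2) * radial 0 (\<theta> / 2 - 1) a * (z \<bullet> z)) = D * (z \<bullet> z)"
          using radial_0[of "\<theta> - 2" a] by (simp add: D_def diff_divide_distrib)
        \<comment> \<open>Splitting |z|^2 as |z|^(1-s) |z|^(s+1) gives a small factor r^(1-s) and a
          profile that is still integrable, since s + 1 > 2s.\<close>
        also have "D * (z \<bullet> z) \<le> D * (r powr (1 - s) * two_scale (s + 1) \<sigma> z)"
        proof (rule mult_left_mono)
          have "z \<bullet> z = norm z powr (1 - s) * norm z powr (s + 1)"
            by (simp flip: powr_add add: power2_norm_eq_inner)
          also have "\<dots> \<le> r powr (1 - s) * two_scale (s + 1) \<sigma> z"
            using True r s by (auto simp: two_scale_def intro!: mult_right_mono powr_mono2)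
          finally show "z \<bullet> z \<le> r powr (1 - s) * two_scale (s + 1) \<sigma> z" .
        qed (use par in \<open>simp add: D_def\<close>)
        finally show ?thesis
          using notS by (simp add: algebra_simps)
      next
        case False
        have f: "f1 z = u (x0 + z)" "f1 (- z) = u (x0 - z)" "f2 z = u (y0 + z)" "f2 (- z) = u (y0 - z)"
          using False by (auto simp: f1_def f2_def g1_def g2_def glue_def dist_norm)
        \<comment> \<open>Moving both points by the same vector leaves x - y unchanged, so only the
          penalty contributes.\<close>
        have shift: "u (x0 + w) - u (y0 + w) - (u x0 - u y0) \<le> \<epsilon> * (?\<psi> (x0 + w) - ?\<psi> x0)" for w
          using max[of "x0 + w" "y0 + w"] a by (simp add: algebra_simps)
        have "u (x0 + z) - u (y0 + z) - (u x0 - u y0) \<le> \<epsilon> * (?\<psi> (x0 + z) - ?\<psi> x0) - ?B * indicator S z"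
        proof (cases "z \<in> S")
          case True
          have n: "x0 + z - y0 = a + z" "x0 - (y0 + z) = a - z" using a by auto
          \<comment> \<open>Here \<open>x0\<close> and \<open>y0\<close> are moved one at a time:
            the differences become a + z and a - z, and adding the two maximality inequalities
            produces the second difference of the power at \<open>a\<close>.\<close>
          have "L * (norm (a + z) powr \<theta> + norm (a - z) powr \<theta> - 2 * norm a powr \<theta>) \<le> L * (- c * norm a powr \<theta>)"
            using True gap par unfolding S_def
            by (intro mult_left_mono norm_powr_second_difference_gap[OF gap(4)]) auto
          moreover have "u (x0 + z) - u y0 - L * norm (a + z) powr \<theta> - \<epsilon> * ?\<psi> (x0 + z)
              \<le> u x0 - u y0 - L * norm a powr \<theta> - \<epsilon> * ?\<psi> x0"
            using max[of "x0 + z" y0] unfolding n(1) .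
          moreover have "u x0 - u (y0 + z) - L * norm (a - z) powr \<theta> - \<epsilon> * ?\<psi> x0
              \<le> u x0 - u y0 - L * norm a powr \<theta> - \<epsilon> * ?\<psi> x0"
            using max[of x0 "y0 + z"] unfolding n(2) .
          ultimately show ?thesis using True by (simp add: algebra_simps)
        qed (use shift in simp)
        moreover have "u (x0 - z) - u (y0 - z) - (u x0 - u y0) \<le> \<epsilon> * (?\<psi> (x0 - z) - ?\<psi> x0)"
          using shift[of "- z"] by simp
        moreover have "0 \<le> D * r powr (1 - s) * two_scale (s + 1) \<sigma> z"
          using par by (intro mult_nonneg_nonneg two_scale_nonneg) (auto simp: D_def)
        ultimately show ?thesis
          using psi unfolding sum f by (simp add: algebra_simps)
      qed
    qed
    have "I f1 0 - I f2 0 \<le> ((E + D * r powr (1 - s)) * Lam * ?N - ?M) / 2"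
    proof (rule elliptic_sym_at_0_le[OF ell s lam t1(3) t2(3)])
      fix K :: "'a \<Rightarrow> real"
      assume K: "K \<in> K_sym s lam Lam" and int: "integrable lebesgue (\<lambda>z. ?g z * K z)"
      have "2 * (LINT z|lebesgue. ?g z * K z) \<le> (E + D * r powr (1 - s)) * Lam * ?N - ?M"
      proof (rule symmetric_kernel_integral_le[OF K int])
        show "0 \<notin> S" "\<And>z. z \<in> S \<Longrightarrow> norm z \<le> norm a"
          using quarter_ball_norm_bounds[of _ a \<rho>] gap na unfolding S_def by force+
        show "emeasure lebesgue S < \<infinity>"
          unfolding S_def using emeasure_lborel_ball_finite by simp
        show "?g z + ?g (- z) \<le> (E + D * r powr (1 - s)) * two_scale (s + 1) \<sigma> z - ?B * indicator S z" for z
          by (rule bound)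
      qed (use s lam par gap in \<open>auto simp: S_def L_integrand_def D_def E_def\<close>)
      then show "(LINT z|lebesgue. ?g z * K z) \<le> ((E + D * r powr (1 - s)) * Lam * ?N - ?M) / 2"
        by simp
    qed
    \<comment> \<open>Subtracting the two viscosity inequalities gives
      \<open>H (p + q) - H p \<le> I f1 0 - I f2 0\<close>.\<close>
    then show ?thesis using visc1 visc2 unfolding I1 I2 by simp
  qed
  have "?M \<le> (E + D * 0) * Lam * ?N + 2 * (H p - H (p + q))"
  proof (rule tendsto_lowerbound)
    show "((\<lambda>r. (E + D * r powr (1 - s)) * Lam * ?N + 2 * (H p - H (p + q))) \<longlongrightarrow>
        (E + D * 0) * Lam * ?N + 2 * (H p - H (p + q))) (at_right 0)"
    proof -
      have "((\<lambda>r. r powr (1 - s)) \<longlongrightarrow> 0 powr (1 - s)) (at_right 0)"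
        using s by (intro tendsto_powr2 tendsto_intros)
          (auto simp: eventually_at_right_field intro!: exI[of _ 1])
      then have "((\<lambda>r. r powr (1 - s)) \<longlongrightarrow> 0) (at_right 0)" by simp
      then show ?thesis by (intro tendsto_intros)
    qed
    show "\<forall>\<^sub>F r in at_right 0. ?M \<le> (E + D * r powr (1 - s)) * Lam * ?N + 2 * (H p - H (p + q))"
      unfolding eventually_at_right_field
      using key na by (intro exI[of _ "min 1 (norm a / 8)"]) auto
  qed simp
  then show ?thesis by (simp add: E_def S_def mult_ac)
qed

section \<open>Exponents and growth\<close>

text \<open>Let b(\<theta>) = 2s - \<theta> - (1 - \<theta>)(m - 1), the power of |a| left in the
  gradient term after division by |a|^(\<theta> - 2s). The conditions are b(\<theta>) > 0 and
  \<gamma> (b(\<theta>) + \<theta>) \<le> \<theta>. If \<gamma> < 1/(2s), any \<theta> close to 1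
  works, the limits being 2s - 1 > 0 and 1 - 2s\<gamma> > 0. Otherwise \<gamma> lies below the other
  exponent, and \<theta> is taken just above a suitable \<theta>0.\<close>

lemma liouville_exponents:
  fixes s m \<gamma>0 :: real
  assumes s: "1 / 2 < s" "s < 1" and m: "1 < m"
    and \<gamma>0: "\<gamma>0 < max ((m - 2 * s) / (m - 1)) (1 / (2 * s))"
  obtains g \<gamma> \<theta> where "\<gamma>0 < g" "0 < g" "g < \<gamma>" "\<gamma> < \<theta>" "\<theta> < 1"
    "0 < 2 * s - \<theta> - (1 - \<theta>) * (m - 1)" "\<gamma> * (2 * s - (1 - \<theta>) * (m - 1)) \<le> \<theta>"
proof -
  \<comment> \<open>Truncation at 0 reduces negative growth exponents to positive ones.\<close>
  define g0 where "g0 = max \<gamma>0 0"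
  have pos: "0 < 1 / (2 * s)" using s by simp
  have "\<exists>\<gamma> \<theta>. g0 < \<gamma> \<and> \<gamma> < \<theta> \<and> \<theta> < 1 \<and> 0 < 2 * s - \<theta> - (1 - \<theta>) * (m - 1)
      \<and> \<gamma> * (2 * s - (1 - \<theta>) * (m - 1)) \<le> \<theta>"
  proof (cases "g0 < 1 / (2 * s)")
    case True
    then obtain \<gamma> where \<gamma>: "g0 < \<gamma>" "\<gamma> < 1 / (2 * s)" using dense by blast
    have "1 / (2 * s) < 1" using s by simp
    have \<gamma>2: "\<gamma> * (2 * s) < 1" using \<gamma>(2) s by (simp add: field_simps)
    have lim1: "((\<lambda>\<theta>. 2 * s - \<theta> - (1 - \<theta>) * (m - 1)) \<longlongrightarrow> 2 * s - 1 - (1 - 1) * (m - 1)) (at_left 1)"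
      by (intro tendsto_intros)
    have lim2: "((\<lambda>\<theta>. \<theta> - \<gamma> * (2 * s - (1 - \<theta>) * (m - 1))) \<longlongrightarrow> 1 - \<gamma> * (2 * s - (1 - 1) * (m - 1))) (at_left 1)"
      by (intro tendsto_intros)
    have "\<forall>\<^sub>F \<theta> in at_left 1. 0 < 2 * s - \<theta> - (1 - \<theta>) * (m - 1)"
      using s by (intro order_tendstoD(1)[OF lim1]) simp
    moreover have "\<forall>\<^sub>F \<theta> in at_left 1. 0 < \<theta> - \<gamma> * (2 * s - (1 - \<theta>) * (m - 1))"
      using \<gamma>2 by (intro order_tendstoD(1)[OF lim2]) simp
    moreover have "\<forall>\<^sub>F \<theta> in at_left 1. \<gamma> < \<theta>"
      using \<gamma>(2) \<open>1 / (2 * s) < 1\<close> by (intro eventually_at_left_real[THEN eventually_mono]) auto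
    moreover have "\<forall>\<^sub>F \<theta> in at_left 1. \<theta> < (1::real)"
      by (rule eventually_at_left_real[of 0, THEN eventually_mono]) auto
    ultimately have "\<forall>\<^sub>F \<theta> in at_left 1. \<gamma> < \<theta> \<and> \<theta> < 1 \<and> 0 < 2 * s - \<theta> - (1 - \<theta>) * (m - 1)
      \<and> \<gamma> * (2 * s - (1 - \<theta>) * (m - 1)) \<le> \<theta>"
      by eventually_elim auto
    from eventually_happens[OF this] show ?thesis using \<gamma>(1) by auto
  next
    case False
    define B where "B = (m - 2 * s) / (m - 1)"
    have "g0 < B" using False \<gamma>0 pos by (auto simp: g0_def B_def max_def split: if_splits)
    then obtain \<gamma> where \<gamma>: "g0 < \<gamma>" "\<gamma> < B" using dense by blast
    have B: "B * (m - 1) = m - 2 * s" using m by (simp add: B_def)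
    have "B < 1" using m s by (simp add: B_def field_simps)
    have "0 < \<gamma>" "\<gamma> < 1" using \<gamma> \<open>B < 1\<close> by (auto simp: g0_def)
    have \<gamma>B: "\<gamma> * (m - 1) < m - 2 * s"
      using mult_strict_right_mono[OF \<gamma>(2), of "m - 1"] m B by simp
    define b where "b = (\<lambda>\<theta>. 2 * s - \<theta> - (1 - \<theta>) * (m - 1))"
    have b_eq: "b \<theta> = b \<gamma> + (\<theta> - \<gamma>) * (m - 2)" for \<theta> by (simp add: b_def algebra_simps)
    have b1: "0 < b 1" using s by (simp add: b_def)
    \<comment> \<open>Both conditions hold, the first weakly and the second strictly, at the left end point of
      the set of \<open>\<theta> \<ge> \<gamma>\<close> with \<open>b \<theta> \<ge> 0\<close>, so they hold strictly just above it.\<close>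
    have "\<exists>\<theta>0. \<gamma> \<le> \<theta>0 \<and> \<theta>0 < 1 \<and> 0 \<le> b \<theta>0 \<and> \<gamma> * (b \<theta>0 + \<theta>0) < \<theta>0"
    proof (cases "0 \<le> b \<gamma>")
      case True
      \<comment> \<open>The inequality b(\<gamma>) + \<gamma> < 1 is a rearrangement of \<gamma> (m
        - 1) < m - 2s.\<close>
      have "\<gamma> * (b \<gamma> + \<gamma>) < \<gamma> * 1"
        using \<gamma>B \<open>0 < \<gamma>\<close> by (intro mult_strict_left_mono) (auto simp: b_def algebra_simps)
      then show ?thesis using True \<open>\<gamma> < 1\<close> by (intro exI[of _ \<gamma>]) auto
    next
      case False
      have slope: "0 < (1 - \<gamma>) * (m - 2)" using False b1 b_eq[of 1] by simp
      then have m2: "0 < m - 2" using \<open>\<gamma> < 1\<close> by (simp add: zero_less_mult_iff)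
      \<comment> \<open>The zero of the affine function \<open>b\<close>, which lies between
        \<gamma> and 1 because \<open>b\<close> changes sign there.\<close>
      define \<theta>0 where "\<theta>0 = \<gamma> - b \<gamma> / (m - 2)"
      have "(\<theta>0 - \<gamma>) * (m - 2) = - b \<gamma>" using m2 by (simp add: \<theta>0_def)
      then have b0: "b \<theta>0 = 0" using b_eq[of \<theta>0] by simp
      have "\<gamma> < \<theta>0" using m2 False by (simp add: \<theta>0_def divide_neg_pos)
      have "\<theta>0 < 1" using b1 b_eq[of 1] m2 by (simp add: \<theta>0_def field_simps)
      have "\<gamma> * (b \<theta>0 + \<theta>0) < \<theta>0"
        using b0 \<open>\<gamma> < 1\<close> \<open>0 < \<gamma>\<close> \<open>\<gamma> < \<theta>0\<close> by simp
      with b0 \<open>\<gamma> < \<theta>0\<close> \<open>\<theta>0 < 1\<close> show ?thesis by (intro exI[of _ \<theta>0]) auto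
    qed
    then obtain \<theta>0 where \<theta>0: "\<gamma> \<le> \<theta>0" "\<theta>0 < 1" "0 \<le> b \<theta>0" "\<gamma> * (b \<theta>0 + \<theta>0) < \<theta>0"
      by blast
    have lim: "((\<lambda>\<theta>. \<theta> - \<gamma> * (b \<theta> + \<theta>)) \<longlongrightarrow> \<theta>0 - \<gamma> * (b \<theta>0 + \<theta>0)) (at_right \<theta>0)"
      unfolding b_def by (intro tendsto_intros)
    have "\<forall>\<^sub>F \<theta> in at_right \<theta>0. 0 < \<theta> - \<gamma> * (b \<theta> + \<theta>)"
      using \<theta>0(4) by (intro order_tendstoD(1)[OF lim]) simp
    moreover have "\<forall>\<^sub>F \<theta> in at_right \<theta>0. \<theta> \<in> {\<theta>0<..<1}"
      using \<theta>0(2) by (rule eventually_at_right_real)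
    ultimately have "\<forall>\<^sub>F \<theta> in at_right \<theta>0. \<theta>0 < \<theta> \<and> \<theta> < 1 \<and> \<gamma> * (b \<theta> + \<theta>) < \<theta>"
      by eventually_elim auto
    from eventually_happens[OF this] obtain \<theta> where \<theta>: "\<theta>0 < \<theta>" "\<theta> < 1" "\<gamma> * (b \<theta> + \<theta>) < \<theta>"
      by auto
    \<comment> \<open>As \<open>b\<close> is affine, its value at \<theta> is a convex combination
      of those at \<theta>0 and 1.\<close>
    have "0 < (1 - \<theta>) * b \<theta>0 + (\<theta> - \<theta>0) * b 1"
      using \<theta> \<theta>0 b1 by (intro add_nonneg_pos mult_pos_pos mult_nonneg_nonneg) auto
    also have "\<dots> = (1 - \<theta>0) * b \<theta>" by (simp add: b_def algebra_simps)
    finally have "0 < b \<theta>" using \<theta>0(2) by (simp add: zero_less_mult_iff)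
    moreover have "b \<theta> + \<theta> = 2 * s - (1 - \<theta>) * (m - 1)" by (simp add: b_def)
    ultimately show ?thesis using \<gamma>(1) \<theta> \<theta>0(1)
      by (intro exI[of _ \<gamma>] exI[of _ \<theta>]) (auto simp: b_def)
  qed
  then obtain \<gamma> \<theta> where *: "g0 < \<gamma>" "\<gamma> < \<theta>" "\<theta> < 1" "0 < 2 * s - \<theta> - (1 - \<theta>) * (m - 1)"
    "\<gamma> * (2 * s - (1 - \<theta>) * (m - 1)) \<le> \<theta>" by blast
  moreover obtain g where "g0 < g" "g < \<gamma>" using dense[OF *(1)] by blast
  ultimately show ?thesis using that[of g \<gamma> \<theta>] by (simp add: g0_def)
qed

section \<open>Growth and existence of the maximum\<close>

lemma usc_lsc_imp_continuous_on:
  fixes u :: "'a::topological_space \<Rightarrow> real"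
  assumes "usc_on S u" "lsc_on S u"
  shows "continuous_on S u"
  unfolding continuous_on_def using assms
  by (auto simp: usc_on_def lsc_on_def intro!: order_tendstoI)

text \<open>\<open>T\<close> is the point where A t^g and B t^h balance: up to \<open>T\<close> the
  constant A T^g suffices, beyond it the higher power wins.\<close>

lemma powr_absorb:
  fixes A B g h :: real
  assumes "0 \<le> A" "0 < B" "0 < g" "g < h"
  obtains C where "0 \<le> C" "\<And>t. 0 \<le> t \<Longrightarrow> A * t powr g \<le> C + B * t powr h"
proof
  define T where "T = (A / B) powr (1 / (h - g))"
  show "0 \<le> A * T powr g" using assms by simp
  fix t :: real assume t: "0 \<le> t"
  show "A * t powr g \<le> A * T powr g + B * t powr h"
  proof (cases "t \<le> T")
    case True
    then have "A * t powr g \<le> A * T powr g"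
      using assms t by (intro mult_left_mono powr_mono2) auto
    then show ?thesis using assms by (simp add: add_increasing2)
  next
    case False
    have "T powr (h - g) \<le> t powr (h - g)" using False assms by (intro powr_mono2) (auto simp: T_def)
    then have "A / B \<le> t powr (h - g)" using assms by (simp add: T_def powr_powr)
    then have "A \<le> B * t powr (h - g)" using assms by (simp add: field_simps)
    then have "A * t powr g \<le> B * t powr (h - g) * t powr g" by (rule mult_right_mono) simp
    also have "\<dots> = B * t powr h" by (simp add: mult.assoc flip: powr_add)
    finally show ?thesis using assms by (simp add: add_increasing)
  qed
qed

text \<open>The growth at \<open>y\<close> is rewritten in terms of \<open>x\<close> and |x - y|,
  the two quantities that the doubled function penalises.\<close>

lemma growth_difference_le:
  fixes u :: "'a::euclidean_space \<Rightarrow> real"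
  assumes growth: "\<And>x. \<bar>u x\<bar> \<le> M * japanese_bracket x powr g" and "0 < g" "g \<le> 1" "0 \<le> M"
  shows "u x - u y \<le> 2 * M * japanese_bracket x powr g + M * norm (x - y) powr g"
proof -
  have "japanese_bracket y \<le> japanese_bracket x + norm (x - y)"
    using japanese_bracket_add_le[of x "y - x"] by (simp add: norm_minus_commute)
  then have "japanese_bracket y powr g \<le> (japanese_bracket x + norm (x - y)) powr g"
    using assms japanese_bracket_ge_1[of y] by (intro powr_mono2) auto
  also have "\<dots> \<le> japanese_bracket x powr g + norm (x - y) powr g"
    using assms japanese_bracket_ge_1[of x] by (intro powr_add_le_add_powr) auto
  finally have "M * japanese_bracket y powr g \<le> M * (japanese_bracket x powr g + norm (x - y) powr g)"
    using \<open>0 \<le> M\<close> by (rule mult_left_mono)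
  then show ?thesis using growth[of x] growth[of y] by (simp add: algebra_simps)
qed

text \<open>Half of each penalty absorbs the growth of order g < \<gamma>, \<theta>. The other half
  bounds \<open>x\<close> and x - y wherever the doubled function is positive, so its maximum over a
  compact product is global.\<close>

lemma doubling_maximum_exists:
  fixes u :: "'a::euclidean_space \<Rightarrow> real"
  assumes cont: "continuous_on UNIV u" and growth: "\<And>x. \<bar>u x\<bar> \<le> M * japanese_bracket x powr g"
    and par: "0 < g" "g \<le> 1" "0 \<le> M" "g < \<gamma>" "g < \<theta>" "0 < L" "0 < \<epsilon>"
    and pos: "0 < u x1 - u y1 - L * norm (x1 - y1) powr \<theta> - \<epsilon> * radial 1 (\<gamma> / 2) x1"
  obtains x0 y0 where "\<And>x y. u x - u y - L * norm (x - y) powr \<theta> - \<epsilon> * radial 1 (\<gamma> / 2) x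
    \<le> u x0 - u y0 - L * norm (x0 - y0) powr \<theta> - \<epsilon> * radial 1 (\<gamma> / 2) x0"
proof -
  define \<Phi> where "\<Phi> = (\<lambda>(x, y). u x - u y - L * norm (x - y) powr \<theta> - \<epsilon> * radial 1 (\<gamma> / 2) x)"
  obtain C1 where C1: "0 \<le> C1" "\<And>t. 0 \<le> t \<Longrightarrow> 2 * M * t powr g \<le> C1 + \<epsilon> / 2 * t powr \<gamma>"
    using powr_absorb[of "2 * M" "\<epsilon> / 2" g \<gamma>] par by auto
  obtain C2 where C2: "0 \<le> C2" "\<And>t. 0 \<le> t \<Longrightarrow> M * t powr g \<le> C2 + L / 2 * t powr \<theta>"
    using powr_absorb[of M "L / 2" g \<theta>] par by auto
  define R1 where "R1 = (2 * (C1 + C2) / \<epsilon>) powr (1 / \<gamma>)"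
  define R2 where "R2 = (2 * (C1 + C2) / L) powr (1 / \<theta>)"
  have root_le: "t \<le> (2 * C / c) powr (1 / e)" if "c / 2 * t powr e \<le> C" "0 < c" "0 < e" "0 \<le> t" for c t e C :: real
  proof -
    have "t powr e \<le> 2 * C / c" using that by (simp add: field_simps)
    then have "(t powr e) powr (1 / e) \<le> (2 * C / c) powr (1 / e)"
      using that by (intro powr_mono2) auto
    then show ?thesis using that by (simp add: powr_powr)
  qed
  have bounded: "x \<in> cball 0 R1 \<and> y \<in> cball 0 (R1 + R2)" if "0 < \<Phi> (x, y)" for x y
  proof -
    have "u x - u y \<le> C1 + \<epsilon> / 2 * japanese_bracket x powr \<gamma> + (C2 + L / 2 * norm (x - y) powr \<theta>)"
      using growth_difference_le[OF growth par(1-3), of x y] C1(2)[of "japanese_bracket x"]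
        C2(2)[of "norm (x - y)"] japanese_bracket_ge_1[of x] by simp
    then have sum: "\<epsilon> / 2 * japanese_bracket x powr \<gamma> + L / 2 * norm (x - y) powr \<theta> < C1 + C2"
      using that by (simp add: \<Phi>_def radial_1_eq)
    moreover have "0 \<le> \<epsilon> / 2 * japanese_bracket x powr \<gamma>" "0 \<le> L / 2 * norm (x - y) powr \<theta>"
      using par by auto
    ultimately have "\<epsilon> / 2 * japanese_bracket x powr \<gamma> \<le> C1 + C2" "L / 2 * norm (x - y) powr \<theta> \<le> C1 + C2"
      by linarith+
    from root_le[OF this(1)] root_le[OF this(2)] have "japanese_bracket x \<le> R1" "norm (x - y) \<le> R2"
      unfolding R1_def R2_def using par japanese_bracket_ge_1[of x] by simp_all
    moreover have "norm y \<le> norm x + norm (x - y)"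
      using norm_triangle_ineq4[of x "x - y"] by simp
    ultimately show ?thesis using norm_le_japanese_bracket[of x] by auto
  qed
  let ?K = "cball (0::'a) R1 \<times> cball (0::'a) (R1 + R2)"
  have in_K: "(x1, y1) \<in> ?K" using bounded[of x1 y1] pos by (simp add: \<Phi>_def)
  have "continuous_on ?K (\<lambda>z. u (fst z) - u (snd z) - L * norm (fst z - snd z) powr \<theta>
      - \<epsilon> * radial 1 (\<gamma> / 2) (fst z))"
    using par by (intro continuous_intros continuous_on_norm_powr continuous_on_radial_1
        continuous_on_compose2[OF cont]) auto
  then have "continuous_on ?K \<Phi>" by (simp add: \<Phi>_def case_prod_beta)
  then obtain z0 where z0: "z0 \<in> ?K" "\<And>z. z \<in> ?K \<Longrightarrow> \<Phi> z \<le> \<Phi> z0"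
    using continuous_attains_sup[of ?K \<Phi>] in_K by (metis compact_Times compact_cball empty_iff)
  \<comment> \<open>Where the function is not positive it lies below its value at (x1, y1), a point
    of the compact set.\<close>
  have "\<Phi> (x, y) \<le> \<Phi> z0" for x y
  proof (cases "0 < \<Phi> (x, y)")
    case True then show ?thesis using bounded z0(2) by auto
  next
    case False
    moreover have "0 < \<Phi> (x1, y1)" using pos by (simp add: \<Phi>_def)
    ultimately show ?thesis using z0(2)[OF in_K] by linarith
  qed
  then show ?thesis using that[of "fst z0" "snd z0"] by (simp add: \<Phi>_def case_prod_beta)
qed

section \<open>The estimate uniform in the maximum point, and the contradiction\<close>

text \<open>\<open>A\<close>, \<open>P\<close>, \<open>Q\<close>, \<open>R\<close> stand for the
  norms of a, p, q, p + q. After multiplication by A^(2s - \<theta>), all remaining powers of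
  \<open>A\<close> are nonnegative and become powers of \<open>J\<close> through A \<le> C
  J^(\<gamma>/\<theta>). The exponent of \<open>J\<close> is then 0 in the first term, by the choice
  of \<sigma>, and at most 0 in the second, by the condition on \<gamma>.\<close>

lemma doubling_estimate:
  fixes A J P Q s m \<theta> \<gamma> \<sigma> L \<epsilon> k C C1 CH :: real
  assumes J: "1 \<le> J" and A: "0 < A" "A \<le> C * J powr (\<gamma> / \<theta>)" and C: "0 < C"
    and par: "0 < \<theta>" "\<theta> < 1" "0 < \<gamma>" "\<gamma> < \<theta>" "0 < L" "0 \<le> \<epsilon>" "1 < m" "\<theta> < 2 * s" "0 \<le> C1" "0 \<le> CH"
    and \<sigma>: "\<sigma> = 2 * s * \<gamma> / \<theta>"
    and b: "0 \<le> 2 * s - \<theta> - (1 - \<theta>) * (m - 1)" "\<gamma> * (2 * s - (1 - \<theta>) * (m - 1)) \<le> \<theta>"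
    and P: "P = L * \<theta> * A powr (\<theta> - 1)" and R: "0 \<le> R" "R \<le> P + Q"
    and Q: "0 \<le> Q" "Q \<le> \<epsilon> * J powr (\<gamma> - 1)"
    and small: "\<epsilon> \<le> L * \<theta> * C powr (\<theta> - 1)"
    and le: "k * L * A powr (\<theta> - 2 * s)
      \<le> \<epsilon> * C1 * J powr (\<gamma> - \<sigma>) + CH * (P powr (m - 1) + R powr (m - 1)) * Q"
  shows "k * L \<le> \<epsilon> * (C1 * C powr (2 * s - \<theta>)
    + CH * (1 + 2 powr (m - 1)) * (L * \<theta>) powr (m - 1) * C powr (2 * s - \<theta> - (1 - \<theta>) * (m - 1)))"
proof -
  define b where "b = 2 * s - \<theta> - (1 - \<theta>) * (m - 1)"
  have Apow: "A powr e \<le> C powr e * J powr (\<gamma> / \<theta> * e)" if "0 \<le> e" for e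
  proof -
    have "A powr e \<le> (C * J powr (\<gamma> / \<theta>)) powr e" using A that by (intro powr_mono2) auto
    then show ?thesis by (simp add: powr_mult powr_powr)
  qed
  \<comment> \<open>For small \<epsilon> the perturbation \<open>q\<close> is dominated by
    \<open>p\<close>, so \<open>R\<close> is at most twice \<open>P\<close>. The comparison of
    exponents amounts to \<gamma> \<le> \<theta>; the bound on \<open>A\<close> is used in reverse
    because \<theta> - 1 is negative.\<close>
  have "Q \<le> P"
  proof -
    have "\<gamma> - 1 \<le> \<gamma> / \<theta> * (\<theta> - 1)" using par by (simp add: field_simps)
    then have "J powr (\<gamma> - 1) \<le> J powr (\<gamma> / \<theta> * (\<theta> - 1))" using J by (intro powr_mono) auto
    then have "\<epsilon> * J powr (\<gamma> - 1) \<le> (L * \<theta> * C powr (\<theta> - 1)) * J powr (\<gamma> / \<theta> * (\<theta> - 1))"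
      using small par by (intro mult_mono) auto
    also have "\<dots> = L * \<theta> * (C * J powr (\<gamma> / \<theta>)) powr (\<theta> - 1)"
      by (simp add: powr_mult powr_powr)
    also have "\<dots> \<le> L * \<theta> * A powr (\<theta> - 1)"
      using A par by (intro mult_left_mono powr_mono2') auto
    finally show ?thesis using Q P by simp
  qed
  have P0: "0 \<le> P" using P par by simp
  have "R powr (m - 1) \<le> (2 * P) powr (m - 1)"
    using R \<open>Q \<le> P\<close> par by (intro powr_mono2) auto
  then have "P powr (m - 1) + R powr (m - 1) \<le> (1 + 2 powr (m - 1)) * P powr (m - 1)"
    by (simp add: powr_mult algebra_simps)
  then have RQ: "CH * (P powr (m - 1) + R powr (m - 1)) * Q
      \<le> CH * ((1 + 2 powr (m - 1)) * P powr (m - 1)) * (\<epsilon> * J powr (\<gamma> - 1))"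
    using par Q by (intro mult_mono mult_left_mono mult_nonneg_nonneg) auto
  have PP: "P powr (m - 1) = (L * \<theta>) powr (m - 1) * A powr ((\<theta> - 1) * (m - 1))"
    by (simp add: P powr_mult powr_powr)
  have "k * L * A powr (\<theta> - 2 * s) \<le> \<epsilon> * C1 * J powr (\<gamma> - \<sigma>)
      + CH * ((1 + 2 powr (m - 1)) * ((L * \<theta>) powr (m - 1) * A powr ((\<theta> - 1) * (m - 1)))) * (\<epsilon> * J powr (\<gamma> - 1))"
    unfolding PP[symmetric] using le RQ by linarith
  then have "k * L * A powr (\<theta> - 2 * s) * A powr (2 * s - \<theta>) \<le> (\<epsilon> * C1 * J powr (\<gamma> - \<sigma>)
      + CH * ((1 + 2 powr (m - 1)) * ((L * \<theta>) powr (m - 1) * A powr ((\<theta> - 1) * (m - 1)))) * (\<epsilon> * J powr (\<gamma> - 1)))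
      * A powr (2 * s - \<theta>)"
    by (rule mult_right_mono) simp
  moreover have "A powr (\<theta> - 2 * s) * A powr (2 * s - \<theta>) = 1"
    using A by (simp flip: powr_add)
  moreover have "A powr ((\<theta> - 1) * (m - 1)) * A powr (2 * s - \<theta>) = A powr b"
    by (simp add: b_def algebra_simps flip: powr_add)
  ultimately have main: "k * L \<le> \<epsilon> * (C1 * (J powr (\<gamma> - \<sigma>) * A powr (2 * s - \<theta>))
      + CH * (1 + 2 powr (m - 1)) * (L * \<theta>) powr (m - 1) * (J powr (\<gamma> - 1) * A powr b))"
    by (simp add: algebra_simps)
  have "J powr (\<gamma> - \<sigma>) * A powr (2 * s - \<theta>)
      \<le> J powr (\<gamma> - \<sigma>) * (C powr (2 * s - \<theta>) * J powr (\<gamma> / \<theta> * (2 * s - \<theta>)))"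
    using par by (intro mult_left_mono Apow) auto
  also have "\<dots> = C powr (2 * s - \<theta>) * J powr ((\<gamma> - \<sigma>) + \<gamma> / \<theta> * (2 * s - \<theta>))"
    by (simp add: powr_add)
  also have "(\<gamma> - \<sigma>) + \<gamma> / \<theta> * (2 * s - \<theta>) = 0" using par by (simp add: \<sigma> field_simps)
  finally have 1: "J powr (\<gamma> - \<sigma>) * A powr (2 * s - \<theta>) \<le> C powr (2 * s - \<theta>)" using J by simp
  have "J powr (\<gamma> - 1) * A powr b \<le> J powr (\<gamma> - 1) * (C powr b * J powr (\<gamma> / \<theta> * b))"
    using assms by (intro mult_left_mono Apow) (auto simp: b_def)
  also have "\<dots> = C powr b * J powr ((\<gamma> - 1) + \<gamma> / \<theta> * b)"
    by (simp add: powr_add)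
  also have "\<dots> \<le> C powr b * J powr 0"
  proof (intro mult_left_mono powr_mono J)
    have "(\<gamma> - 1) + \<gamma> / \<theta> * b = (\<gamma> * (2 * s - (1 - \<theta>) * (m - 1)) - \<theta>) / \<theta>"
      using par by (simp add: b_def field_simps)
    also have "\<dots> \<le> 0" using b(2) par by (simp add: divide_nonpos_pos)
    finally show "(\<gamma> - 1) + \<gamma> / \<theta> * b \<le> 0" .
  qed simp
  finally have 2: "J powr (\<gamma> - 1) * A powr b \<le> C powr b" using J by simp
  have "\<epsilon> * (C1 * (J powr (\<gamma> - \<sigma>) * A powr (2 * s - \<theta>))
      + CH * (1 + 2 powr (m - 1)) * (L * \<theta>) powr (m - 1) * (J powr (\<gamma> - 1) * A powr b))
    \<le> \<epsilon> * (C1 * C powr (2 * s - \<theta>) + CH * (1 + 2 powr (m - 1)) * (L * \<theta>) powr (m - 1) * C powr b)"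
    using par by (intro mult_left_mono add_mono 1 2) auto
  with main show ?thesis by (simp add: b_def)
qed

text \<open>The argument is by contradiction with \<open>L\<close> fixed and \<epsilon> chosen after
  all other constants: the maximum point may run off as \<epsilon> shrinks, but k L \<le> \<epsilon>
  T holds with \<open>k\<close> and \<open>T\<close> independent of it.\<close>

lemma viscosity_solution_holder:
  fixes u :: "'a::euclidean_space \<Rightarrow> real" and H :: "'a \<Rightarrow> real"
  assumes s: "1 / 2 < s" "s < 1" and lam: "0 < lam" "lam \<le> Lam"
    and trans: "translation_invariant s I" and ell: "elliptic_sym s lam Lam I"
    and visc: "viscosity_solution s I (\<lambda>x t p. H p) UNIV u"
    and m: "1 < m" and C\<^sub>H: "0 < C\<^sub>H"
    and H: "\<And>p q. \<bar>H p - H q\<bar> \<le> C\<^sub>H * (norm p powr (m - 1) + norm q powr (m - 1)) * norm (p - q)"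
    and growth: "\<And>x. \<bar>u x\<bar> \<le> M * japanese_bracket x powr g" and M: "0 \<le> M"
    and par: "0 < g" "g < \<gamma>" "\<gamma> < \<theta>" "\<theta> < 1"
    and b: "0 < 2 * s - \<theta> - (1 - \<theta>) * (m - 1)" "\<gamma> * (2 * s - (1 - \<theta>) * (m - 1)) \<le> \<theta>"
    and L: "0 < L"
  shows "u x1 - u y1 \<le> L * norm (x1 - y1) powr \<theta>"
proof (rule ccontr)
  assume "\<not> u x1 - u y1 \<le> L * norm (x1 - y1) powr \<theta>"
  moreover define d where "d = u x1 - u y1 - L * norm (x1 - y1) powr \<theta>"
  ultimately have d: "0 < d" by simp
  have sub: "viscosity_subsolution s I (\<lambda>x t p. H p) UNIV u"
    and super: "viscosity_supersolution s I (\<lambda>x t p. H p) UNIV u"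
    using visc by (auto simp: viscosity_solution_def)
  have cont: "continuous_on UNIV u"
    using sub super by (intro usc_lsc_imp_continuous_on)
      (auto simp: viscosity_subsolution_def viscosity_supersolution_def)
  have par': "0 < \<theta>" "0 < \<gamma>" "\<gamma> < 1" "g \<le> 1" "g < \<theta>" "\<theta> < 2 * s" using par s by auto
  \<comment> \<open>The value that cancels the powers of J in \<open>doubling_estimate\<close>. Then
    \<gamma> < \<sigma> follows from \<theta> < 2s, and \<sigma> < 2s from \<gamma> <
    \<theta>.\<close>
  define \<sigma> where "\<sigma> = 2 * s * \<gamma> / \<theta>"
  have "\<gamma> * \<theta> < 2 * s * \<gamma>" using par' by simp
  then have \<sigma>: "\<gamma> < \<sigma>" "\<sigma> < 2 * s" using par par' s by (auto simp: \<sigma>_def field_simps)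
  obtain \<rho> c where gap: "0 < \<rho>" "\<rho> \<le> 1 / 8" "0 < c"
    "(5 / 4 + \<rho>) powr \<theta> + (3 / 4 + \<rho>) powr \<theta> \<le> 2 - c"
    using powr_concavity_gap[OF par'(1) par(4)] by metis
  obtain C0 where C0: "0 \<le> C0" "\<And>t. 0 \<le> t \<Longrightarrow> M * t powr g \<le> C0 + L / 2 * t powr \<theta>"
    using powr_absorb[of M "L / 2" g \<theta>] M L par par' by auto
  \<comment> \<open>The root obtained from (L/2) |a|^\<theta> \<le> (2M + C0 + 1) J^\<gamma>; the
    summand 1 keeps it positive when \<open>M\<close> and \<open>C0\<close> vanish.\<close>
  define C where "C = (2 * (2 * M + C0 + 1) / L) powr (1 / \<theta>)"
  have C: "0 < C" using M C0(1) L by (simp add: C_def)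
  define N where "N = (LINT z|lebesgue. two_scale (s + 1) \<sigma> (z::'a) * norm z powr (- real DIM('a) - 2 * s))"
  have N: "0 \<le> N"
    unfolding N_def by (intro Bochner_Integration.integral_nonneg mult_nonneg_nonneg two_scale_nonneg) simp
  \<comment> \<open>The concavity gain times the lower kernel constant times the volume of the
    quarter ball, with all powers of |a| removed.\<close>
  define k where "k = c * lam * \<rho> ^ DIM('a) * unit_ball_vol (real DIM('a))"
  have k: "0 < k" using gap lam by (simp add: k_def)
  define T where "T = (2 * Lam * N) * C powr (2 * s - \<theta>)
    + (2 * C\<^sub>H) * (1 + 2 powr (m - 1)) * (L * \<theta>) powr (m - 1) * C powr (2 * s - \<theta> - (1 - \<theta>) * (m - 1))"
  have T: "0 \<le> T"
    unfolding T_def using lam N C\<^sub>H by (intro add_nonneg_nonneg mult_nonneg_nonneg) auto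
  have psi: "0 < radial 1 (\<gamma> / 2) x" for x :: 'a
    using japanese_bracket_ge_1[of x] by (simp add: radial_1_eq)
  \<comment> \<open>The three bounds keep the doubled function positive at (x1, y1), make |q| \<le>
    |p|, and force \<epsilon> T < k L. \<open>T + 1\<close> avoids division by 0.\<close>
  define \<epsilon> where "\<epsilon> = min (d / (2 * radial 1 (\<gamma> / 2) x1)) (min (L * \<theta> * C powr (\<theta> - 1)) (k * L / (2 * (T + 1))))"
  have \<epsilon>: "0 < \<epsilon>" using d psi[of x1] L par' C k T by (simp add: \<epsilon>_def)
  have "\<epsilon> * radial 1 (\<gamma> / 2) x1 \<le> d / (2 * radial 1 (\<gamma> / 2) x1) * radial 1 (\<gamma> / 2) x1"
    using psi[of x1] by (intro mult_right_mono) (auto simp: \<epsilon>_def)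
  also have "\<dots> = d / 2" using psi[of x1] by simp
  finally have pos: "0 < u x1 - u y1 - L * norm (x1 - y1) powr \<theta> - \<epsilon> * radial 1 (\<gamma> / 2) x1"
    using d unfolding d_def[symmetric] by linarith
  obtain x0 y0 where max: "\<And>x y. u x - u y - L * norm (x - y) powr \<theta> - \<epsilon> * radial 1 (\<gamma> / 2) x
      \<le> u x0 - u y0 - L * norm (x0 - y0) powr \<theta> - \<epsilon> * radial 1 (\<gamma> / 2) x0"
    using doubling_maximum_exists[OF cont growth par(1) par'(4) M par(2) par'(5) L \<epsilon> pos] by metis
  define a where "a = x0 - y0"
  have max_pos: "0 < u x0 - u y0 - L * norm a powr \<theta> - \<epsilon> * radial 1 (\<gamma> / 2) x0"
    using pos max[of x1 y1] unfolding a_def by linarith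
  \<comment> \<open>On the diagonal the doubled function is minus the penalty, hence
    negative.\<close>
  have a: "a \<noteq> 0"
  proof
    assume "a = 0"
    then have "x0 = y0" by (simp add: a_def)
    then have "\<epsilon> * radial 1 (\<gamma> / 2) x0 < 0" using max_pos by (simp add: \<open>a = 0\<close>)
    then show False using \<epsilon> psi[of x0] by (simp add: mult_less_0_iff)
  qed
  define A where "A = norm a"
  define J where "J = japanese_bracket x0"
  have A: "0 < A" using a by (simp add: A_def)
  have J: "1 \<le> J" unfolding J_def by (rule japanese_bracket_ge_1)
  have A_le: "A \<le> C * J powr (\<gamma> / \<theta>)"
  proof -
    have "L * A powr \<theta> \<le> u x0 - u y0"
      using max_pos mult_pos_pos[OF \<epsilon> psi[of x0]] by (simp add: A_def)
    also have "\<dots> \<le> 2 * M * J powr g + M * A powr g"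
      using growth_difference_le[OF growth par(1) par'(4) M, of x0 y0] by (simp add: A_def J_def a_def)
    also have "\<dots> \<le> 2 * M * J powr g + (C0 + L / 2 * A powr \<theta>)"
      using C0(2)[of A] A by simp
    finally have "L / 2 * A powr \<theta> \<le> 2 * M * J powr g + C0" by simp
    also have "\<dots> \<le> 2 * M * J powr \<gamma> + (C0 + 1) * J powr \<gamma>"
    proof (intro add_mono mult_left_mono powr_mono)
      have "(C0 + 1) * 1 \<le> (C0 + 1) * J powr \<gamma>"
        using C0(1) J par' by (intro mult_left_mono) (auto simp: ge_one_powr_ge_zero)
      then show "C0 \<le> (C0 + 1) * J powr \<gamma>" by simp
    qed (use J M par in auto)
    finally have "A powr \<theta> \<le> 2 * (2 * M + C0 + 1) / L * J powr \<gamma>"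
      using L by (simp add: field_simps)
    then have "(A powr \<theta>) powr (1 / \<theta>) \<le> (2 * (2 * M + C0 + 1) / L * J powr \<gamma>) powr (1 / \<theta>)"
      using par' by (intro powr_mono2) auto
    then show ?thesis using A par' unfolding powr_mult C_def by (simp add: powr_powr)
  qed
  define p where "p = (L * \<theta> * norm a powr (\<theta> - 2)) *\<^sub>R a"
  define q where "q = (\<epsilon> * \<gamma> * japanese_bracket x0 powr (\<gamma> - 2)) *\<^sub>R x0"
  have P: "norm p = L * \<theta> * A powr (\<theta> - 1)"
    using L par' A powr_add[of A "\<theta> - 2" 1] by (simp add: p_def A_def)
  have Q: "norm q \<le> \<epsilon> * J powr (\<gamma> - 1)"
  proof -
    have "norm q = \<epsilon> * \<gamma> * J powr (\<gamma> - 2) * norm x0"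
      using \<epsilon> par' by (simp add: q_def J_def)
    also have "\<dots> \<le> \<epsilon> * 1 * J powr (\<gamma> - 2) * J"
      using \<epsilon> par' norm_le_japanese_bracket[of x0] by (intro mult_mono mult_nonneg_nonneg) (auto simp: J_def)
    also have "\<dots> = \<epsilon> * J powr (\<gamma> - 1)"
      using J powr_add[of J "\<gamma> - 2" 1] by simp
    finally show ?thesis .
  qed
  have "c * L * norm a powr \<theta> * lam * norm a powr (- real DIM('a) - 2 * s)
      * measure lebesgue (ball ((1 / 4) *\<^sub>R a) (\<rho> * norm a))
    \<le> \<epsilon> * 2 * japanese_bracket x0 powr (\<gamma> - \<sigma>) * Lam * N + 2 * (H p - H (p + q))"
    unfolding N_def using s \<sigma> \<epsilon>
    by (intro doubling_inequality[OF s lam trans ell sub super par'(1) par(4) par'(2,3) \<sigma> _ L _ gap a_def a _ p_def q_def])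
      (use max in \<open>auto simp: a_def\<close>)
  also have "c * L * norm a powr \<theta> * lam * norm a powr (- real DIM('a) - 2 * s)
      * measure lebesgue (ball ((1 / 4) *\<^sub>R a) (\<rho> * norm a)) = k * L * A powr (\<theta> - 2 * s)"
  proof -
    have vol: "measure lebesgue (ball ((1 / 4) *\<^sub>R a) (\<rho> * A)) = unit_ball_vol (real DIM('a)) * (\<rho> ^ DIM('a) * A powr DIM('a))"
      using gap A by (simp add: content_ball power_mult_distrib powr_realpow)
    have "A powr (\<theta> - 2 * s) = A powr (\<theta> + (- real DIM('a) - 2 * s) + DIM('a))" by simp
    also have "\<dots> = A powr \<theta> * A powr (- real DIM('a) - 2 * s) * A powr DIM('a)"
      by (simp only: powr_add)
    finally show ?thesis unfolding A_def[symmetric] vol k_def by (simp add: mult_ac)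
  qed
  also have "\<epsilon> * 2 * japanese_bracket x0 powr (\<gamma> - \<sigma>) * Lam * N + 2 * (H p - H (p + q))
      \<le> \<epsilon> * (2 * Lam * N) * J powr (\<gamma> - \<sigma>)
        + (2 * C\<^sub>H) * (norm p powr (m - 1) + norm (p + q) powr (m - 1)) * norm q"
  proof -
    have "H p - H (p + q) \<le> C\<^sub>H * (norm p powr (m - 1) + norm (p + q) powr (m - 1)) * norm q"
      using H[of p "p + q"] by simp
    then show ?thesis by (simp add: J_def algebra_simps)
  qed
  finally have "k * L \<le> \<epsilon> * T"
    unfolding T_def
  proof (intro doubling_estimate[OF J A A_le C par'(1) par(4) par'(2) par(3) L _ m par'(6) _ _ \<sigma>_def _ b(2) P])
    show "\<epsilon> \<le> L * \<theta> * C powr (\<theta> - 1)" by (simp add: \<epsilon>_def)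
  qed (use \<epsilon> lam N C\<^sub>H b Q norm_triangle_ineq[of p q] in auto)
  also have "\<epsilon> * T \<le> k * L / (2 * (T + 1)) * T"
    using T by (intro mult_right_mono) (auto simp: \<epsilon>_def)
  also have "\<dots> < k * L"
  proof -
    have "T / (2 * (T + 1)) < 1" using T by simp
    from mult_strict_left_mono[OF this mult_pos_pos[OF k L]] show ?thesis by simp
  qed
  finally show False by simp
qed

theorem theorem1p2:
  fixes s lam Lam m C\<^sub>H :: real
    and H :: "real ^ 'n \<Rightarrow> real"
    and I :: "(real ^ 'n \<Rightarrow> real) \<Rightarrow> real ^ 'n \<Rightarrow> real"
  assumes "1 / 2 < s" and "s < 1"
    and "0 < lam" and "lam \<le> Lam"
    and "\<forall>p. \<exists>r>0. \<exists>L. L-lipschitz_on (ball p r) H"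
    and "1 < m" and "0 < C\<^sub>H"
    and "\<forall>p q. \<bar>H p - H q\<bar> \<le> C\<^sub>H * (norm p powr (m - 1) + norm q powr (m - 1)) * norm (p - q)"
    and "translation_invariant s I"
    and "positively_homogeneous s I"
    and "elliptic_sym s lam Lam I"
  shows "\<not> (\<exists>u. \<not> u constant_on UNIV \<and>
              viscosity_solution s I (\<lambda>x t p. H p) UNIV u \<and>
              (\<exists>M \<gamma>. \<gamma> < max ((m - 2 * s) / (m - 1)) (1 / (2 * s)) \<and>
                     (\<forall>x. \<bar>u x\<bar> \<le> M * (1 + norm x) powr \<gamma>)))"
proof
  assume "\<exists>u. \<not> u constant_on UNIV \<and>
              viscosity_solution s I (\<lambda>x t p. H p) UNIV u \<and>
              (\<exists>M \<gamma>. \<gamma> < max ((m - 2 * s) / (m - 1)) (1 / (2 * s)) \<and>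
                     (\<forall>x. \<bar>u x\<bar> \<le> M * (1 + norm x) powr \<gamma>))"
  then obtain u M \<gamma>0 where nonconst: "\<not> u constant_on UNIV"
    and visc: "viscosity_solution s I (\<lambda>x t p. H p) UNIV u"
    and \<gamma>0: "\<gamma>0 < max ((m - 2 * s) / (m - 1)) (1 / (2 * s))"
    and growth: "\<And>x. \<bar>u x\<bar> \<le> M * (1 + norm x) powr \<gamma>0"
    by blast
  obtain g \<gamma> \<theta> where par: "\<gamma>0 < g" "0 < g" "g < \<gamma>" "\<gamma> < \<theta>" "\<theta> < 1"
    "0 < 2 * s - \<theta> - (1 - \<theta>) * (m - 1)" "\<gamma> * (2 * s - (1 - \<theta>) * (m - 1)) \<le> \<theta>"
    using liouville_exponents[OF assms(1,2,6) \<gamma>0] by metis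
  have M: "0 \<le> M" using growth[of 0] by simp
  \<comment> \<open>1 + |x| is at most twice the bracket, and the exponent may be raised to g > 0
    since 1 + |x| \<ge> 1.\<close>
  have growth': "\<bar>u x\<bar> \<le> (M * 2 powr g) * japanese_bracket x powr g" for x
  proof -
    have "(1 + norm x) powr \<gamma>0 \<le> (1 + norm x) powr g"
      using par by (intro powr_mono) auto
    also have "\<dots> \<le> (2 * japanese_bracket x) powr g"
      using par one_plus_norm_pos[of x] norm_le_japanese_bracket[of x] japanese_bracket_ge_1[of x]
      by (intro powr_mono2) auto
    finally have "M * (1 + norm x) powr \<gamma>0 \<le> M * (2 * japanese_bracket x) powr g"
      using M by (rule mult_left_mono)
    then show ?thesis using growth[of x] by (simp add: powr_mult)
  qed
  have le: "u x \<le> u y" for x y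
  proof (rule field_le_epsilon)
    fix e :: real assume "0 < e"
    show "u x \<le> u y + e"
    proof (cases "x = y")
      case False
      then have D: "0 < norm (x - y) powr \<theta>" by simp
      \<comment> \<open>For a fixed pair, \<open>L\<close> is chosen so that the bound is exactly
        \<open>e\<close>.\<close>
      have "u x - u y \<le> e / norm (x - y) powr \<theta> * norm (x - y) powr \<theta>"
      proof (rule viscosity_solution_holder[OF assms(1-4,9,11) visc assms(6,7) _ growth' _ par(2-7)])
        show "\<bar>H p - H q\<bar> \<le> C\<^sub>H * (norm p powr (m - 1) + norm q powr (m - 1)) * norm (p - q)" for p q
          using assms(8) by blast
      qed (use M D \<open>0 < e\<close> in auto)
      then show ?thesis using D by simp
    qed (use \<open>0 < e\<close> in simp)
  qed
  have "u constant_on UNIV"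
    unfolding constant_on_def by (intro exI[of _ "u 0"] ballI antisym le)
  with nonconst show False by contradiction
qed

end
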